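(* Let $K_0=K_1=0$ and, for $n\ge 2$, let $K_n$ be the number of degree-biased cuts needed to erase a random recursive tree of size $n$. Then $\mathbf{P}(K_2=1)=\mathbf{P}(K_3=1)=1$, and for $n\ge 4$, \[\mathbf{P}(K_n=1)=\frac{H_{n-2}}{(n-1)^2}+\frac{H_{n-1}}{n-1},\] \[\mathbf{P}(K_n=j)=\sum_{k=2}^{n-2}\frac{nH_{k-1}}{k(k+1)(n-1)}\mathbf{P}(K_{n-k}=j-1),\qquad j\ge 2.\]
   Context: An increasing tree on $[n]=\{1,\dots,n\}$ is a rooted labeled tree with vertex set $[n]$ in which labels along any path away from the root increase (so the root is $1$). A random recursive tree $T_n$ of size $n$ is a uniformly random element of the set of increasing trees on $[n]$. An edge is written $v_1v_2$ with $v_1<v_2$ (so $v_1$ is the parent of $v_2$). For a vertex $v$ of a tree $t$, $t^{(v)}$ is the subtree rooted at $v$, consisting of $v$ and all its descendants. $H_m=\sum_{i=1}^m i^{-1}$ is the $m$-th harmonic number. Degree-biased cut: given an increasing tree $t$ (possibly with a vertex set of labels other than $[n]$) with at least two vertices, choose an edge $v_1v_2$ of $t$ uniformly at random. If $v_1$ is not the root, let $v_0$ be the parent of $v_1$ and set $t^{root}:=t\setminus(t^{(v_1)}\cup v_0v_1)$, the subtree containing the root after deleting $t^{(v_1)}$ and the edge $v_0v_1$. If $v_1$ is the root, set $t^{root}:=\emptyset$. Degree-biased process and $K_n$: for $n\ge 2$, let $G_0=T_n$ and, for $t\ge1$, let $G_t=G_{t-1}^{root}$ (obtained by a new degree-biased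 cut of $G_{t-1}$) if $|G_{t-1}|\ge 2$, and $G_t=G_{t-1}$ otherwise, where $|\cdot|$ is the number of vertices. Then $K_n=\min\{t\ge 1: |G_t|\in\{0,1\}\}$. *)

theory Defs
  imports "HOL-Probability.Probability" "HOL-Analysis.Harmonic_Numbers"
begin

text \<open>An edge is the pair (parent, child).\<close>

record ltree =
  verts :: "nat set"
  edges :: "(nat \<times> nat) set"

definition empty_tree :: ltree where
  "empty_tree = \<lparr>verts = {}, edges = {}\<rparr>"

definition is_rooted_tree :: "ltree \<Rightarrow> nat \<Rightarrow> bool" where
  "is_rooted_tree t r \<longleftrightarrow>
     finite (verts t) \<and> edges t \<subseteq> verts t \<times> verts t \<and> r \<in> verts t \<and>
     (\<forall>u. (u, r) \<notin> edges t) \<and>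
     (\<forall>v\<in>verts t - {r}. \<exists>!u. (u, v) \<in> edges t) \<and>
     (\<forall>v\<in>verts t. (r, v) \<in> (edges t)\<^sup>*)"

definition increasing_tree :: "ltree \<Rightarrow> bool" where
  "increasing_tree t \<longleftrightarrow>
     (\<exists>r. is_rooted_tree t r) \<and> (\<forall>u v. (u, v) \<in> (edges t)\<^sup>+ \<longrightarrow> u < v)"

definition increasing_trees_on :: "nat set \<Rightarrow> ltree set" where
  "increasing_trees_on V = {t. increasing_tree t \<and> verts t = V}"

definition random_recursive_tree :: "nat \<Rightarrow> ltree pmf" where
  "random_recursive_tree n = pmf_of_set (increasing_trees_on {1..n})"

definition root :: "ltree \<Rightarrow> nat" where
  "root t = (THE r. is_rooted_tree t r)"

definition parent :: "ltree \<Rightarrow> nat \<Rightarrow> nat" where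
  "parent t v = (THE u. (u, v) \<in> edges t)"

definition subtree_at :: "ltree \<Rightarrow> nat \<Rightarrow> ltree" where
  "subtree_at t v =
     (let D = {w \<in> verts t. (v, w) \<in> (edges t)\<^sup>*}
      in \<lparr>verts = D, edges = edges t \<inter> (D \<times> D)\<rparr>)"

text \<open>The part of \<open>t\<close> that survives the cut when the edge \<open>e\<close>, with parent endpoint
  \<open>fst e\<close>, has been chosen.\<close>

definition root_part :: "ltree \<Rightarrow> nat \<times> nat \<Rightarrow> ltree" where
  "root_part t e =
     (let v = fst e; s = subtree_at t v in
      if v = root t then empty_tree
      else \<lparr>verts = verts t - verts s,
            edges = edges t - (edges s \<union> {(parent t v, v)})\<rparr>)"

definition degree_biased_cut :: "ltree \<Rightarrow> ltree pmf" where
  "degree_biased_cut t = map_pmf (root_part t) (pmf_of_set (edges t))"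

definition degree_biased_step :: "ltree \<Rightarrow> ltree pmf" where
  "degree_biased_step t =
     (if card (verts t) \<ge> 2 then degree_biased_cut t else return_pmf t)"

text \<open>The last conjunct says that, given the past \<open>G 0, \<dots>, G t\<close>, the tree
  \<open>G (Suc t)\<close> is produced by a fresh random step from \<open>G t\<close>.  It is written with a product
  rather than a quotient, so that histories of probability zero need no separate treatment.\<close>

definition degree_biased_process ::
    "nat \<Rightarrow> 'a measure \<Rightarrow> (nat \<Rightarrow> 'a \<Rightarrow> ltree) \<Rightarrow> bool" where
  "degree_biased_process n M G \<longleftrightarrow>
     prob_space M \<and>
     (\<forall>t. G t \<in> M \<rightarrow>\<^sub>M count_space UNIV) \<and>
     distr M (count_space UNIV) (G 0) = measure_pmf (random_recursive_tree n) \<and>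
     (\<forall>t h g.
        \<P>(\<omega> in M. (\<forall>s\<le>t. G s \<omega> = h s) \<and> G (Suc t) \<omega> = g) =
        \<P>(\<omega> in M. \<forall>s\<le>t. G s \<omega> = h s) * pmf (degree_biased_step (h t)) g)"

text \<open>A trajectory that never reaches a tree with at most one vertex has probability zero, so the
  unspecified value of \<open>LEAST\<close> there does not matter.\<close>

definition num_cuts :: "nat \<Rightarrow> (nat \<Rightarrow> 'a \<Rightarrow> ltree) \<Rightarrow> 'a \<Rightarrow> nat" where
  "num_cuts n G \<omega> =
     (if n < 2 then 0 else (LEAST t. t \<ge> 1 \<and> card (verts (G t \<omega>)) \<in> {0, 1}))"

lemma finite_increasing_trees_on:
  assumes "finite V"
  shows "finite (increasing_trees_on V)"
proof (rule finite_subset)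
  show "increasing_trees_on V \<subseteq> (\<lambda>E. \<lparr>verts = V, edges = E\<rparr>) ` Pow (V \<times> V)"
  proof
    fix t assume "t \<in> increasing_trees_on V"
    then have "edges t \<subseteq> V \<times> V" "t = \<lparr>verts = V, edges = edges t\<rparr>"
      by (auto simp: increasing_trees_on_def increasing_tree_def is_rooted_tree_def)
    then show "t \<in> (\<lambda>E. \<lparr>verts = V, edges = E\<rparr>) ` Pow (V \<times> V)" by blast
  qed
qed (use assms in auto)

lemma increasing_trees_on_nonempty:
  assumes "n \<ge> 1"
  shows "increasing_trees_on {1..n} \<noteq> {}"
proof -
  define E where "E = {1::nat} \<times> {2..n}"
  have "\<exists>!u. (u, v) \<in> E" if "v \<in> {1..n} - {1}" for v
    using that by (intro ex1I[of _ 1]) (auto simp: E_def)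
  moreover have "(1, v) \<in> E\<^sup>*" if "v \<in> {1..n}" for v
    using that by (cases "v = 1") (auto simp: E_def intro!: r_into_rtrancl)
  ultimately have "is_rooted_tree \<lparr>verts = {1..n}, edges = E\<rparr> 1"
    using assms by (auto simp: is_rooted_tree_def E_def)
  moreover have "u < v" if "(u, v) \<in> E\<^sup>+" for u v
    using that by (induction rule: trancl_induct) (auto simp: E_def)
  ultimately have "\<lparr>verts = {1..n}, edges = E\<rparr> \<in> increasing_trees_on {1..n}"
    by (auto simp: increasing_trees_on_def increasing_tree_def)
  then show ?thesis by blast
qed

text \<open>The process exists: run it with independent random maps, the \<open>t\<close>-th of which sends each
  tree on labels from \<open>{1..n}\<close> to the outcome of its \<open>t\<close>-th step.\<close>

lemma degree_biased_process_exists: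
  assumes "n \<ge> 1"
  shows "\<exists>(M :: (nat \<Rightarrow> ltree \<Rightarrow> ltree) measure) G. degree_biased_process n M G"
proof -
  define S :: "ltree set" where "S = {t. verts t \<subseteq> {1..n} \<and> edges t \<subseteq> {1..n} \<times> {1..n}}"
  have "S \<subseteq> (\<lambda>(V, E). \<lparr>verts = V, edges = E\<rparr>) ` (Pow {1..n} \<times> Pow ({1..n} \<times> {1..n}))"
  proof
    fix t :: ltree assume "t \<in> S"
    then show "t \<in> (\<lambda>(V, E). \<lparr>verts = V, edges = E\<rparr>) ` (Pow {1..n} \<times> Pow ({1..n} \<times> {1..n}))"
      by (intro image_eqI[of _ _ "(verts t, edges t)"]) (auto simp: S_def)
  qed
  then have fin: "finite S" by (rule finite_subset) auto
  have e_S: "empty_tree \<in> S" by (auto simp: S_def empty_tree_def)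
  have root_part_S: "root_part t e \<in> S" if "t \<in> S" for t e
    using that by (auto simp: S_def root_part_def empty_tree_def Let_def)
  have step_S: "set_pmf (degree_biased_step t) \<subseteq> S" if "t \<in> S" for t
    using that root_part_S by (auto simp: degree_biased_step_def degree_biased_cut_def)
  have init_S: "set_pmf (random_recursive_tree n) \<subseteq> S"
    using finite_increasing_trees_on[of "{1..n}"] increasing_trees_on_nonempty[OF assms]
    unfolding random_recursive_tree_def
    by (auto simp: S_def increasing_trees_on_def increasing_tree_def is_rooted_tree_def)

  define clip where "clip x = (if x \<in> S then x else empty_tree)" for x
  have clip_S: "clip x \<in> S" for x using e_S by (simp add: clip_def)
  have map_clip: "map_pmf clip p = p" if "set_pmf p \<subseteq> S" for p
    using that by (intro map_pmf_idI) (auto simp: clip_def)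
  define q :: "nat \<Rightarrow> (ltree \<Rightarrow> ltree) pmf" where
    "q i = (if i = 0 then map_pmf (\<lambda>x _. x) (random_recursive_tree n)
            else Pi_pmf S empty_tree degree_biased_step)" for i
  define P where "P = PiM UNIV (\<lambda>i. measure_pmf (q i))"
  define G where "G = (\<lambda>t \<omega>. rec_nat (clip (\<omega> 0 empty_tree)) (\<lambda>t x. clip (\<omega> (Suc t) x)) t)"
  have G_0: "G 0 \<omega> = clip (\<omega> 0 empty_tree)" and
       G_Suc: "G (Suc t) \<omega> = clip (\<omega> (Suc t) (G t \<omega>))" for t and \<omega> :: "nat \<Rightarrow> ltree \<Rightarrow> ltree"
    by (simp_all add: G_def)
  interpret product_prob_space "\<lambda>i. measure_pmf (q i)" UNIV
    by (intro product_prob_spaceI) (auto intro: measure_pmf.prob_space_axioms)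
  have prob: "prob_space P" unfolding P_def by (rule prob_space_axioms)
  have comp: "(\<lambda>\<omega>. f (\<omega> i)) \<in> P \<rightarrow>\<^sub>M count_space A" if "\<And>x. f x \<in> A"
    for i and f :: "(ltree \<Rightarrow> ltree) \<Rightarrow> ltree" and A :: "ltree set"
  proof (rule measurable_compose[of "\<lambda>\<omega>. \<omega> i" _ "measure_pmf (q i)"])
    show "(\<lambda>\<omega>. \<omega> i) \<in> P \<rightarrow>\<^sub>M measure_pmf (q i)" unfolding P_def by (rule measurable_component_singleton) simp
    show "f \<in> measure_pmf (q i) \<rightarrow>\<^sub>M count_space A" using that by auto
  qed
  have meas_S: "G t \<in> P \<rightarrow>\<^sub>M count_space S" for t
  proof (induction t)
    case 0
    show ?case using comp[of "\<lambda>f. clip (f empty_tree)" S 0] clip_S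
      unfolding G_0[abs_def] by simp
  next
    case (Suc t)
    show ?case unfolding G_Suc[abs_def]
      by (rule measurable_compose_countable'[OF _ Suc]) (use fin comp clip_S in \<open>auto intro: countable_finite\<close>)
  qed
  have meas: "G t \<in> P \<rightarrow>\<^sub>M count_space UNIV" for t
    using measurable_compose[OF meas_S, of "\<lambda>x. x"] by simp

  have law0: "map_pmf (\<lambda>f. clip (f empty_tree)) (q 0) = random_recursive_tree n"
    using map_clip[OF init_S] by (simp add: q_def pmf.map_comp o_def)
  have law: "map_pmf (\<lambda>f. clip (f x)) (q (Suc t)) = degree_biased_step x" if "x \<in> S" for x t
  proof -
    have "map_pmf (\<lambda>f. clip (f x)) (q (Suc t)) = map_pmf clip (map_pmf (\<lambda>f. f x) (q (Suc t)))"
      by (simp add: pmf.map_comp o_def)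
    also have "map_pmf (\<lambda>f. f x) (q (Suc t)) = degree_biased_step x"
      using that fin by (simp add: q_def Pi_pmf_component)
    finally show ?thesis using map_clip[OF step_S[OF that]] by simp
  qed
  have init: "distr P (count_space UNIV) (G 0) = measure_pmf (random_recursive_tree n)"
  proof -
    have "distr P (count_space UNIV) (G 0) =
        distr (distr P (measure_pmf (q 0)) (\<lambda>\<omega>. \<omega> 0)) (count_space UNIV) (\<lambda>f. clip (f empty_tree))"
      unfolding G_0[abs_def] P_def by (subst distr_distr) (auto simp: o_def)
    also have "distr P (measure_pmf (q 0)) (\<lambda>\<omega>. \<omega> 0) = measure_pmf (q 0)"
      unfolding P_def by (rule PiM_component) simp
    also have "distr (measure_pmf (q 0)) (count_space UNIV) (\<lambda>f. clip (f empty_tree)) =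
        measure_pmf (random_recursive_tree n)"
      by (simp flip: law0 add: map_pmf_rep_eq)
    finally show ?thesis .
  qed

  define B where "B h i = (case i of 0 \<Rightarrow> {f. clip (f empty_tree) = h 0}
      | Suc s \<Rightarrow> {f. clip (f (h s)) = h (Suc s)})" for h :: "nat \<Rightarrow> ltree" and i
  have hist: "(\<forall>s\<le>t. G s \<omega> = h s) \<longleftrightarrow> (\<forall>s\<le>t. \<omega> s \<in> B h s)" for t \<omega> h
  proof (induction t)
    case 0
    show ?case by (simp add: B_def G_0)
  next
    case (Suc t)
    have "(\<forall>s\<le>Suc t. G s \<omega> = h s) \<longleftrightarrow> (\<forall>s\<le>t. G s \<omega> = h s) \<and> clip (\<omega> (Suc t) (h t)) = h (Suc t)"
      by (metis G_Suc le_Suc_eq order_refl)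
    also have "\<dots> \<longleftrightarrow> (\<forall>s\<le>Suc t. \<omega> s \<in> B h s)"
      unfolding Suc by (auto simp: le_Suc_eq B_def)
    finally show ?case .
  qed
  have prob_hist: "\<P>(\<omega> in P. \<forall>s\<le>t. G s \<omega> = h s) = (\<Prod>s\<le>t. measure (q s) (B h s))" for t h
  proof -
    have "{\<omega> \<in> space P. \<forall>s\<le>t. G s \<omega> = h s} =
        prod_emb UNIV (\<lambda>i. measure_pmf (q i)) {..t} (Pi\<^sub>E {..t} (B h))"
      unfolding hist by (auto simp: P_def prod_emb_def space_PiM PiE_def Pi_def)
    then show ?thesis unfolding P_def by (simp add: measure_PiM_emb)
  qed
  have B_Suc: "measure (q (Suc t)) (B h (Suc t)) = pmf (degree_biased_step (h t)) (h (Suc t))"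
    if "h t \<in> S" for t h
  proof -
    have "pmf (map_pmf (\<lambda>f. clip (f (h t))) (q (Suc t))) (h (Suc t)) =
        measure (q (Suc t)) (B h (Suc t))"
      unfolding pmf_map by (rule arg_cong[of _ _ "measure _"]) (auto simp: B_def)
    then show ?thesis using law[OF that] by simp
  qed
  have "\<P>(\<omega> in P. (\<forall>s\<le>t. G s \<omega> = h s) \<and> G (Suc t) \<omega> = g) =
      \<P>(\<omega> in P. \<forall>s\<le>t. G s \<omega> = h s) * pmf (degree_biased_step (h t)) g" for t h g
  proof (cases "h t \<in> S")
    case True
    define h' where "h' = h(Suc t := g)"
    have "\<P>(\<omega> in P. (\<forall>s\<le>t. G s \<omega> = h s) \<and> G (Suc t) \<omega> = g) =
        \<P>(\<omega> in P. \<forall>s\<le>Suc t. G s \<omega> = h' s)"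
      by (rule arg_cong[of _ _ "measure _"]) (auto simp: h'_def le_Suc_eq)
    also have "\<dots> = \<P>(\<omega> in P. \<forall>s\<le>t. G s \<omega> = h' s) * pmf (degree_biased_step (h' t)) (h' (Suc t))"
    proof -
      have "h' t \<in> S" using True by (simp add: h'_def)
      then show ?thesis using B_Suc[of h' t] unfolding prob_hist by simp
    qed
    also have "{\<omega> \<in> space P. \<forall>s\<le>t. G s \<omega> = h' s} = {\<omega> \<in> space P. \<forall>s\<le>t. G s \<omega> = h s}"
      by (auto simp: h'_def)
    finally show ?thesis by (simp add: h'_def)
  next
    case False
    have "G t \<omega> \<in> S" for \<omega> by (cases t) (auto simp: G_0 G_Suc clip_S)
    then have *: "\<not> (\<forall>s\<le>t. G s \<omega> = h s)" for \<omega> using False by (metis order_refl)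
    show ?thesis by (simp only: *) simp
  qed
  then have "degree_biased_process n P G"
    using prob meas init by (auto simp: degree_biased_process_def)
  then show ?thesis by blast
qed

end

theory Submission
  imports Defs
begin

text \<open>
Condition on the first cut of a random recursive tree.  The chosen edge \<open>e\<close> is at the root with
probability \<open>H\<^sub>n\<^sub>-\<^sub>1 / (n - 1)\<close>, since the mean root degree is \<open>H\<^sub>n\<^sub>-\<^sub>1\<close>, and then the tree is erased.
Otherwise the cut removes the subtree \<open>s\<close> of some other vertex, with label set \<open>D\<close>.  The tree
together with \<open>e\<close> is the same as: the surviving tree \<open>g\<close> on the other labels, the vertex \<open>u\<close> of \<open>g\<close>
below which \<open>s\<close> was hanging, with \<open>u < Min D\<close>, the tree \<open>s\<close> on \<open>D\<close>, and an edge at the root of \<open>s\<close>,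
all chosen freely (\<open>sum_root_part\<close>).

So, given \<open>D\<close>, the tree \<open>g\<close> is uniform and the process starts afresh.  The probability that \<open>k\<close>
vertices are removed is a count: the pairs of \<open>D\<close> and \<open>u\<close> correspond to the sets
of \<open>k + 1\<close> labels, namely \<open>D\<close> together with \<open>u\<close> as a new minimum (\<open>sum_card_less_Min\<close>); there are
\<open>(k - 1)! H\<^sub>k\<^sub>-\<^sub>1\<close> trees on \<open>D\<close> with a marked edge at the root (\<open>card_and_root_degrees\<close>), and
\<open>(n - k - 1)!\<close> trees \<open>g\<close>.  Dividing by the \<open>(n - 1)! (n - 1)\<close> pairs of a tree and an edge gives
\<open>n H\<^sub>k\<^sub>-\<^sub>1 / (k (k + 1) (n - 1))\<close> for \<open>1 \<le> k \<le> n - 1\<close> (\<open>mean_absorb_prob_Suc\<close>).  The term \<open>k = n - 1\<close>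
leaves the root alone and belongs to one cut; the term \<open>k = 1\<close> vanishes.

On the side of probability, the distribution of the number of cuts is the mean over random recursive
trees of the absorption probabilities \<open>absorb_prob\<close> of the chain started at a fixed tree.  This
follows from the product formula for histories (\<open>prob_history_absorbed_after\<close>), together with the
fact that absorption is certain (\<open>AE_absorbed\<close>).
\<close>

section \<open>Cutting and grafting increasing trees\<close>

lemma rooted_increasing_root:
  assumes "is_rooted_tree t r" and inc: "\<And>u v. (u, v) \<in> (edges t)\<^sup>+ \<Longrightarrow> u < v"
  shows "r = Min (verts t)"
proof -
  have "r \<le> v" if "v \<in> verts t" for v
    using assms(1) inc[of r v] that by (auto simp: is_rooted_tree_def rtrancl_eq_or_trancl intro: less_imp_le)
  then show ?thesis using assms(1)
    by (intro Min_eqI[symmetric]) (auto simp: is_rooted_tree_def)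
qed

text \<open>Reachability from the root comes for free: following parents strictly decreases the label, so the
walk can only stop at the minimum.  Membership thus becomes a condition on single edges, which can
be checked separately on the pieces of a tree.\<close>

lemma increasing_trees_on_iff:
  assumes "finite V" "V \<noteq> {}"
  shows "t \<in> increasing_trees_on V \<longleftrightarrow>
    verts t = V \<and> edges t \<subseteq> {(u, v). u \<in> V \<and> v \<in> V \<and> u < v} \<and>
    (\<forall>v\<in>V - {Min V}. \<exists>!u. (u, v) \<in> edges t)" (is "?L \<longleftrightarrow> ?R")
proof
  assume ?L
  then obtain r where r: "is_rooted_tree t r" and inc: "\<And>u v. (u, v) \<in> (edges t)\<^sup>+ \<Longrightarrow> u < v"
    and V: "verts t = V" by (auto simp: increasing_trees_on_def increasing_tree_def)
  have "r = Min V" using rooted_increasing_root[OF r inc] V by simp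
  then show ?R using r inc V by (auto simp: is_rooted_tree_def)
next
  assume R: ?R
  then have V: "verts t = V" and E: "\<And>u v. (u, v) \<in> edges t \<Longrightarrow> u \<in> V \<and> v \<in> V \<and> u < v"
    and par: "\<And>v. v \<in> V \<Longrightarrow> v \<noteq> Min V \<Longrightarrow> \<exists>!u. (u, v) \<in> edges t" by auto
  have reach: "(Min V, v) \<in> (edges t)\<^sup>*" if "v \<in> V" for v
    using that
  proof (induction v rule: less_induct)
    case (less v)
    show ?case
    proof (cases "v = Min V")
      case False
      then obtain u where u: "(u, v) \<in> edges t" using par less.prems by blast
      then have "(Min V, u) \<in> (edges t)\<^sup>*" using E less.IH by blast
      then show ?thesis using u by (rule rtrancl_into_rtrancl)
    qed auto
  qed
  have min: "(u, Min V) \<notin> edges t" for u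
    using E[of u "Min V"] Min_le[OF assms(1), of u] by auto
  have "is_rooted_tree t (Min V)"
    using assms V E par reach min by (auto simp: is_rooted_tree_def)
  moreover have "u < v" if "(u, v) \<in> (edges t)\<^sup>+" for u v
    using that by (induction rule: trancl_induct) (auto dest: E)
  ultimately show ?L using V by (auto simp: increasing_trees_on_def increasing_tree_def)
qed

lemma increasing_trees_onD:
  assumes "t \<in> increasing_trees_on V"
  shows "finite V" "V \<noteq> {}" "verts t = V" "is_rooted_tree t (Min V)" "root t = Min V"
    "(u, v) \<in> edges t \<Longrightarrow> u \<in> V \<and> v \<in> V \<and> u < v"
    "v \<in> V \<Longrightarrow> v \<noteq> Min V \<Longrightarrow> \<exists>!u. (u, v) \<in> edges t"
    "v \<in> V \<Longrightarrow> (Min V, v) \<in> (edges t)\<^sup>*"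
    "finite (edges t)"
proof -
  obtain r where r: "is_rooted_tree t r" and inc: "\<And>u v. (u, v) \<in> (edges t)\<^sup>+ \<Longrightarrow> u < v"
    and V: "verts t = V" using assms by (auto simp: increasing_trees_on_def increasing_tree_def)
  have rV: "r = Min V" using rooted_increasing_root[OF r inc] V by simp
  show fin: "finite V" and ne: "V \<noteq> {}" and "verts t = V" and rt: "is_rooted_tree t (Min V)"
    using r V rV by (auto simp: is_rooted_tree_def)
  show "root t = Min V" unfolding root_def
    using rt rooted_increasing_root[OF _ inc] V by (intro the_equality) auto
  note iff = iffD1[OF increasing_trees_on_iff[OF fin ne] assms]
  show "(u, v) \<in> edges t \<Longrightarrow> u \<in> V \<and> v \<in> V \<and> u < v" using iff by blast
  show "v \<in> V \<Longrightarrow> v \<noteq> Min V \<Longrightarrow> \<exists>!u. (u, v) \<in> edges t" using iff by simp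
  show "v \<in> V \<Longrightarrow> (Min V, v) \<in> (edges t)\<^sup>*" using rt V by (auto simp: is_rooted_tree_def)
  show "finite (edges t)" using rt V fin by (auto simp: is_rooted_tree_def intro: finite_subset)
qed

text \<open>The inverse of a cut.  The edge is attached at \<open>Min (verts s)\<close> because that is the root of an
increasing tree \<open>s\<close>.\<close>

definition graft :: "ltree \<Rightarrow> nat \<Rightarrow> ltree \<Rightarrow> ltree" where
  "graft g u s =
     \<lparr>verts = verts g \<union> verts s, edges = edges g \<union> edges s \<union> {(u, Min (verts s))}\<rparr>"

lemma Min_diff:
  fixes V :: "'a::linorder set"
  assumes "finite V" "V \<noteq> {}" "Min V \<notin> D"
  shows "Min (V - D) = Min V"
  using assms by (intro Min_eqI) auto

text \<open>First half of the bijection between pairs (tree, vertex other than the root) and grafting data.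
Each label of \<open>D\<close> keeps its parent in \<open>s\<close>, except \<open>Min D\<close>, which had none and receives \<open>u\<close>; the
condition \<open>u < Min D\<close> is exactly what keeps labels increasing along the new edge.  Edges never
lead from \<open>D\<close> to the outside, so the descendants of \<open>Min D\<close> are precisely \<open>D\<close> and cutting there
returns the pieces.\<close>

lemma
  assumes g: "g \<in> increasing_trees_on (V - D)" and s: "s \<in> increasing_trees_on D"
    and D: "D \<subseteq> V - {Min V}" and u: "u \<in> V" "u < Min D"
  shows graft_in_increasing_trees_on: "graft g u s \<in> increasing_trees_on V"
    and subtree_at_graft: "subtree_at (graft g u s) (Min D) = s"
    and parent_graft: "parent (graft g u s) (Min D) = u"
    and root_part_graft: "root_part (graft g u s) (Min D, w) = g"
proof -
  note gD = increasing_trees_onD[OF g] and sD = increasing_trees_onD[OF s]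
  let ?t = "graft g u s"
  have fin: "finite V" and ne: "V \<noteq> {}" using gD(1,2) sD(1) by auto
  have uD: "u \<notin> D" using u(2) sD(1) by (meson Min_le leD)
  have MinD: "Min D \<in> D" using sD(1,2) by simp
  have minV: "Min (V - D) = Min V" using fin ne D by (intro Min_diff) auto
  have verts: "verts ?t = V" using gD(3) sD(3) D by (auto simp: graft_def)
  have edges: "edges ?t = edges g \<union> edges s \<union> {(u, Min D)}" using sD(3) by (simp add: graft_def)
  have no_root_edge: "(x, Min D) \<notin> edges s" for x
    using sD(6)[of x "Min D"] sD(1) by (meson Min_le leD)
  have par: "(x, v) \<in> edges ?t \<longleftrightarrow>
      (if v = Min D then x = u else if v \<in> D then (x, v) \<in> edges s else (x, v) \<in> edges g)" for x v
    using edges no_root_edge MinD gD(6)[of x v] sD(6)[of x v] by auto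
  show t: "?t \<in> increasing_trees_on V"
    unfolding increasing_trees_on_iff[OF fin ne]
  proof (intro conjI ballI)
    show "edges ?t \<subseteq> {(u, v). u \<in> V \<and> v \<in> V \<and> u < v}"
      unfolding edges using gD(6) sD(6) u MinD D by blast
    show "\<exists>!x. (x, v) \<in> edges ?t" if "v \<in> V - {Min V}" for v
    proof -
      consider "v = Min D" | "v \<in> D" "v \<noteq> Min D" | "v \<notin> D" by blast
      then show ?thesis
      proof cases
        case 3
        then have "v \<noteq> Min D" using MinD by auto
        then show ?thesis unfolding par using 3 that gD(7)[of v] minV by simp
      qed (use that sD(7)[of v] in \<open>simp_all add: par\<close>)
    qed
  qed (fact verts)
  have "w \<in> D" if "(Min D, w) \<in> (edges ?t)\<^sup>*" for w
    using that
  proof (induction rule: rtrancl_induct)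
    case (step y z)
    then show ?case using edges gD(6)[of y z] sD(6)[of y z] MinD by auto
  qed (fact MinD)
  moreover have "(Min D, w) \<in> (edges ?t)\<^sup>*" if "w \<in> D" for w
    using sD(8)[OF that] rtrancl_mono[of "edges s" "edges ?t"] edges by auto
  ultimately have desc: "{w \<in> verts ?t. (Min D, w) \<in> (edges ?t)\<^sup>*} = D"
    using verts D by auto
  have "edges ?t \<inter> D \<times> D = edges s"
    unfolding edges using sD(6) gD(6) uD by auto
  then show sub: "subtree_at ?t (Min D) = s"
    unfolding subtree_at_def Let_def desc using sD(3) by simp
  show parent: "parent ?t (Min D) = u"
    unfolding parent_def by (rule the_equality) (simp_all add: par)
  have "edges ?t - (edges s \<union> {(u, Min D)}) = edges g"
    unfolding edges using sD(6) gD(6) MinD by auto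
  moreover have "V - D = verts g" using gD(3) by simp
  moreover have "Min D \<noteq> root ?t" using increasing_trees_onD(5)[OF t] MinD D by auto
  ultimately show "root_part ?t (Min D, w) = g"
    unfolding root_part_def Let_def using sub parent verts sD(3) by simp
qed

text \<open>Second half of the bijection.  The set of descendants of \<open>v\<close> is closed under taking children, and
under taking parents except at \<open>v\<close> itself, because parents are unique.  Hence the only edge
between this set and its complement is the one from the parent of \<open>v\<close> to \<open>v\<close>, and the tree is
recovered by grafting.\<close>

lemma
  fixes w :: nat
  assumes t: "t \<in> increasing_trees_on V" and v: "v \<in> V" "v \<noteq> Min V"
  defines "D \<equiv> verts (subtree_at t v)" and "g \<equiv> root_part t (v, w)"
  shows verts_subtree_at_subset: "D \<subseteq> V - {Min V}"
    and Min_subtree_at: "Min D = v"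
    and subtree_at_in_increasing_trees_on: "subtree_at t v \<in> increasing_trees_on D"
    and root_part_in_increasing_trees_on: "g \<in> increasing_trees_on (V - D)"
    and parent_mem: "parent t v \<in> V"
    and parent_less: "parent t v < v"
    and graft_root_part_subtree_at: "graft g (parent t v) (subtree_at t v) = t"
    and edges_from_subtree_at: "(v, x) \<in> edges t \<Longrightarrow> (v, x) \<in> edges (subtree_at t v)"
proof -
  note tD = increasing_trees_onD[OF t]
  have D: "D = {x \<in> V. (v, x) \<in> (edges t)\<^sup>*}"
    unfolding D_def subtree_at_def Let_def using tD(3) by simp
  have sE: "edges (subtree_at t v) = edges t \<inter> D \<times> D"
    unfolding D_def subtree_at_def Let_def by simp
  have le: "v \<le> x" if "(v, x) \<in> (edges t)\<^sup>*" for x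
    using that by (induction rule: rtrancl_induct) (auto dest: tD(6))
  have vD: "v \<in> D" using v D by simp
  have closed: "y \<in> D" if "(x, y) \<in> edges t" "x \<in> D" for x y
    using that D tD(6) by (auto intro: rtrancl_into_rtrancl)
  have entry: "x \<in> D" if xy: "(x, y) \<in> edges t" and y: "y \<in> D" "y \<noteq> v" for x y
  proof -
    have "(v, y) \<in> (edges t)\<^sup>*" using y D by simp
    then obtain z where z: "(v, z) \<in> (edges t)\<^sup>*" "(z, y) \<in> edges t"
      using y(2) by (cases rule: rtranclE) auto
    have "y \<noteq> Min V" using tD(6)[OF xy] tD(1) by (meson Min_le leD)
    then have "z = x" using tD(7)[of y] tD(6)[OF xy] z xy by blast
    then show ?thesis using z tD(6)[OF xy] D by simp
  qed
  have fin: "finite D" using D tD(1) by simp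
  have "Min V < v" using v tD(1,2) by (metis Min_le le_neq_implies_less)
  then show DV: "D \<subseteq> V - {Min V}" using D le[of "Min V"] by auto
  show MinD: "Min D = v" using fin vD D le by (intro Min_eqI) auto
  obtain p where p: "(p, v) \<in> edges t" and p_uniq: "\<And>x. (x, v) \<in> edges t \<Longrightarrow> x = p"
    using tD(7)[OF v] by blast
  have pv: "parent t v = p"
    unfolding parent_def using p p_uniq by (rule the_equality)
  show "parent t v \<in> V" and pless: "parent t v < v" using tD(6)[OF p] pv by auto
  have pD: "p \<notin> D" using le[of p] pless pv D by auto
  show s: "subtree_at t v \<in> increasing_trees_on D"
    using fin vD unfolding increasing_trees_on_iff[OF fin, OF ex_in_conv[THEN iffD1, OF exI, OF vD]]
  proof (intro conjI ballI)
    show "edges (subtree_at t v) \<subseteq> {(u, v). u \<in> D \<and> v \<in> D \<and> u < v}"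
      unfolding sE using tD(6) by auto
    show "\<exists>!x. (x, y) \<in> edges (subtree_at t v)" if y: "y \<in> D - {Min D}" for y
    proof -
      have "y \<in> V" "y \<noteq> Min V" using y DV by auto
      then obtain x where x: "(x, y) \<in> edges t" "\<And>z. (z, y) \<in> edges t \<Longrightarrow> z = x"
        using tD(7)[of y] by (metis (no_types))
      have "x \<in> D" using entry[OF x(1)] y MinD by auto
      then show ?thesis unfolding sE using x y by (intro ex1I[of _ x]; blast)
    qed
  qed (simp add: D_def)
  have not_root: "v \<noteq> root t" using tD(5) v by simp
  have gv: "verts g = V - D"
    unfolding g_def root_part_def Let_def using not_root tD(3) D_def by simp
  have "edges g = edges t - (edges t \<inter> D \<times> D \<union> {(p, v)})"
    unfolding g_def root_part_def Let_def using not_root pv sE by simp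
  also have "\<dots> = edges t \<inter> (V - D) \<times> (V - D)"
  proof (rule set_eqI, clarify)
    fix x y
    show "(x, y) \<in> edges t - (edges t \<inter> D \<times> D \<union> {(p, v)}) \<longleftrightarrow>
        (x, y) \<in> edges t \<inter> (V - D) \<times> (V - D)"
      using closed[of x y] entry[of x y] tD(6)[of x y] p_uniq[of x] vD by blast
  qed
  finally have gE: "edges g = edges t \<inter> (V - D) \<times> (V - D)" .
  have min: "Min (V - D) = Min V" using tD(1,2) DV by (intro Min_diff) auto
  have ne: "V - D \<noteq> {}" using DV tD(1,2) by (metis Diff_eq_empty_iff Min_in insertCI subset_Diff_insert subset_iff)
  have fin': "finite (V - D)" using tD(1) by simp
  show "g \<in> increasing_trees_on (V - D)"
    unfolding increasing_trees_on_iff[OF fin' ne]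
  proof (intro conjI ballI)
    show "edges g \<subseteq> {(u, v). u \<in> V - D \<and> v \<in> V - D \<and> u < v}"
      unfolding gE using tD(6) by auto
    show "\<exists>!x. (x, y) \<in> edges g" if y: "y \<in> V - D - {Min (V - D)}" for y
    proof -
      have "y \<in> V" "y \<noteq> Min V" using y min by auto
      then obtain x where x: "(x, y) \<in> edges t" "\<And>z. (z, y) \<in> edges t \<Longrightarrow> z = x"
        using tD(7)[of y] by (metis (no_types))
      have "x \<in> V - D" using tD(6)[OF x(1)] closed[OF x(1)] y by auto
      then show ?thesis unfolding gE using x y by (intro ex1I[of _ x]; blast)
    qed
  qed (fact gv)
  have "edges t \<inter> (V - D) \<times> (V - D) \<union> edges t \<inter> D \<times> D \<union> {(p, v)} = edges t"
  proof (rule set_eqI, clarify)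
    fix x y
    show "(x, y) \<in> edges t \<inter> (V - D) \<times> (V - D) \<union> edges t \<inter> D \<times> D \<union> {(p, v)} \<longleftrightarrow>
        (x, y) \<in> edges t"
      using closed[of x y] entry[of x y] p tD(6)[of x y] p_uniq[of x] by blast
  qed
  moreover have "V - D \<union> D = V" using DV by auto
  ultimately show "graft g (parent t v) (subtree_at t v) = t"
    unfolding graft_def using gv gE sE pv MinD tD(3) by (auto simp: D_def[symmetric])
  show "(v, x) \<in> edges t \<Longrightarrow> (v, x) \<in> edges (subtree_at t v)"
    unfolding sE using vD closed by auto
qed

text \<open>What remains after a cut is again a state of the same kind and strictly smaller; this makes
induction along the chain possible and bounds the time until absorption.\<close>

lemma
  assumes t: "t \<in> increasing_trees_on V" and e: "e \<in> edges t"
  shows root_part_increasing_or_empty: "root_part t e = empty_tree \<or> increasing_tree (root_part t e)"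
    and card_verts_root_part_less: "card (verts (root_part t e)) < card V"
proof -
  obtain v w where vw: "e = (v, w)" by (cases e) auto
  then have v: "v \<in> V" using increasing_trees_onD(6)[OF t, of v w] e by simp
  have "(root_part t e = empty_tree \<or> increasing_tree (root_part t e)) \<and> card (verts (root_part t e)) < card V"
  proof (cases "v = Min V")
    case True
    then have "root_part t e = empty_tree"
      using vw increasing_trees_onD(5)[OF t] by (simp add: root_part_def)
    then show ?thesis using increasing_trees_onD(1,2)[OF t] by (simp add: empty_tree_def card_gt_0_iff)
  next
    case False
    let ?D = "verts (subtree_at t v)"
    have "?D \<noteq> {}" "?D \<subseteq> V"
      using increasing_trees_onD(2)[OF subtree_at_in_increasing_trees_on[OF t v False]]
        verts_subtree_at_subset[OF t v False] by auto
    then have "V - ?D \<subset> V" by blast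
    then have "card (V - ?D) < card V" by (rule psubset_card_mono[OF increasing_trees_onD(1)[OF t]])
    then show ?thesis
      using root_part_in_increasing_trees_on[OF t v False, of w] vw by (auto simp: increasing_trees_on_def)
  qed
  then show "root_part t e = empty_tree \<or> increasing_tree (root_part t e)"
    "card (verts (root_part t e)) < card V" by auto
qed

section \<open>Counting cuts by the part that they remove\<close>

lemma increasing_trees_on_finite [simp]: "finite (increasing_trees_on V)"
proof (cases "finite V")
  case False
  then have "increasing_trees_on V = {}" using increasing_trees_onD(1) by blast
  then show ?thesis by simp
qed (rule finite_increasing_trees_on)

lemma increasing_trees_on_singleton: "increasing_trees_on {v} = {\<lparr>verts = {v}, edges = {}\<rparr>}"
proof -
  have "t \<in> increasing_trees_on {v} \<longleftrightarrow> t = \<lparr>verts = {v}, edges = {}\<rparr>" for t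
  proof -
    have "t \<in> increasing_trees_on {v} \<longleftrightarrow> verts t = {v} \<and> edges t = {}"
      by (subst increasing_trees_on_iff) auto
    then show ?thesis by (cases t) auto
  qed
  then show ?thesis by blast
qed

definition leaf :: "nat \<Rightarrow> ltree" where
  "leaf v = \<lparr>verts = {v}, edges = {}\<rparr>"

definition root_degree :: "ltree \<Rightarrow> nat" where
  "root_degree t = card {e \<in> edges t. fst e = root t}"

text \<open>The largest label is always a leaf, and it may hang below any of the other vertices.  This is the
recursive growth of increasing trees; here it is the graft of a one-vertex tree.\<close>

lemma sum_insert_max:
  fixes F :: "ltree \<Rightarrow> 'b::comm_monoid_add"
  assumes V: "finite V" "V \<noteq> {}" and m: "\<And>v. v \<in> V \<Longrightarrow> v < m"
  shows "(\<Sum>t\<in>increasing_trees_on (insert m V). F t) =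
    (\<Sum>g\<in>increasing_trees_on V. \<Sum>u\<in>V. F (graft g u (leaf m)))"
proof -
  let ?W = "insert m V"
  have mV: "m \<notin> V" using m by blast
  have Min: "Min ?W = Min V" using V m[OF Min_in[OF V]] by (intro Min_eqI) auto
  have mMin: "m \<noteq> Min ?W" using Min V m[of "Min V"] by simp
  have D: "{m} \<subseteq> ?W - {Min ?W}" "?W - {m} = V" using mMin mV by auto
  have leaf: "leaf m \<in> increasing_trees_on {m}" by (simp add: leaf_def increasing_trees_on_singleton)
  have "(\<Sum>g\<in>increasing_trees_on V. \<Sum>u\<in>V. F (graft g u (leaf m))) =
      (\<Sum>(g, u)\<in>increasing_trees_on V \<times> V. F (graft g u (leaf m)))"
    by (simp add: sum.cartesian_product)
  also have "\<dots> = (\<Sum>t\<in>increasing_trees_on ?W. F t)"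
  proof (rule sum.reindex_bij_witness[
        where i = "\<lambda>t. (root_part t (m, m), parent t m)" and j = "\<lambda>(g, u). graft g u (leaf m)"])
    fix t assume t: "t \<in> increasing_trees_on ?W"
    have mW: "m \<in> ?W" by simp
    let ?s = "subtree_at t m"
    have s: "?s \<in> increasing_trees_on (verts ?s)" "Min (verts ?s) = m" "verts ?s \<subseteq> ?W - {Min ?W}"
      using subtree_at_in_increasing_trees_on[OF t mW mMin] Min_subtree_at[OF t mW mMin]
        verts_subtree_at_subset[OF t mW mMin] by auto
    have "verts ?s \<subseteq> {m}"
    proof
      fix x assume x: "x \<in> verts ?s"
      then have "m \<le> x" using s(2) increasing_trees_onD(1)[OF s(1)] by (metis Min_le)
      then show "x \<in> {m}" using x s(3) m by fastforce
    qed
    then have sm: "verts ?s = {m}" using increasing_trees_onD(2)[OF s(1)] by auto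
    then have leaf: "?s = leaf m" using s(1) by (simp add: increasing_trees_on_singleton leaf_def)
    show "(root_part t (m, m), parent t m) \<in> increasing_trees_on V \<times> V"
      using root_part_in_increasing_trees_on[OF t mW mMin, of m] parent_mem[OF t mW mMin]
        parent_less[OF t mW mMin] sm mV by auto
    show "(case (root_part t (m, m), parent t m) of (g, u) \<Rightarrow> graft g u (leaf m)) = t"
      using graft_root_part_subtree_at[OF t mW mMin, of m] leaf by simp
  next
    fix gu assume "gu \<in> increasing_trees_on V \<times> V"
    then obtain g u where gu: "gu = (g, u)" and g: "g \<in> increasing_trees_on (?W - {m})"
      and u: "u \<in> ?W" "u < Min {m}" using D(2) m by (cases gu) auto
    show "(case gu of (g, u) \<Rightarrow> graft g u (leaf m)) \<in> increasing_trees_on ?W"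
      using graft_in_increasing_trees_on[OF g leaf D(1) u] gu by simp
    show "(root_part (case gu of (g, u) \<Rightarrow> graft g u (leaf m)) (m, m),
        parent (case gu of (g, u) \<Rightarrow> graft g u (leaf m)) m) = gu"
      using root_part_graft[OF g leaf D(1) u] parent_graft[OF g leaf D(1) u] gu by simp
  qed auto
  finally show ?thesis by simp
qed

lemma root_degree_graft_leaf:
  assumes g: "g \<in> increasing_trees_on V" and m: "\<And>v. v \<in> V \<Longrightarrow> v < m" and u: "u \<in> V"
  shows "root_degree (graft g u (leaf m)) = root_degree g + of_bool (u = Min V)"
proof -
  note gD = increasing_trees_onD[OF g]
  have mV: "m \<notin> V" using m by blast
  have Min: "Min (insert m V) = Min V" using gD(1,2) m[OF Min_in[OF gD(1,2)]] by (intro Min_eqI) auto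
  have "graft g u (leaf m) \<in> increasing_trees_on (insert m V)"
  proof (rule graft_in_increasing_trees_on[where D = "{m}"])
    show "g \<in> increasing_trees_on (insert m V - {m})" using g mV by simp
    have "Min V \<in> V" using gD(1,2) by simp
    then show "{m} \<subseteq> insert m V - {Min (insert m V)}" using mV by (auto simp: Min)
  qed (use u m in \<open>auto simp: leaf_def increasing_trees_on_singleton\<close>)
  then have r: "root (graft g u (leaf m)) = Min V" using increasing_trees_onD(5) Min by metis
  have "{e \<in> edges (graft g u (leaf m)). fst e = Min V} =
      (if u = Min V then insert (u, m) else id) {e \<in> edges g. fst e = Min V}"
    by (auto simp: graft_def leaf_def)
  moreover have "(u, m) \<notin> edges g" using gD(6) mV by blast
  ultimately show ?thesis
    unfolding root_degree_def r gD(5) using gD(9) by auto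
qed

text \<open>With \<open>A\<close> the number of trees on \<open>m\<close> labels and \<open>R\<close> their total root degree, hanging a new largest
label in all \<open>m\<close> ways turns \<open>A\<close> into \<open>m A\<close> and \<open>R\<close> into \<open>m R + A\<close>, as in each tree exactly one of the
\<open>m\<close> positions is the root.  Dividing by factorials, the mean root degree grows by \<open>1 / m\<close>.\<close>

lemma card_and_root_degrees:
  assumes "finite V" "V \<noteq> {}"
  shows "card (increasing_trees_on V) = fact (card V - 1) \<and>
    real (\<Sum>t\<in>increasing_trees_on V. root_degree t) = fact (card V - 1) * harm (card V - 1)"
  using assms
proof (induction V rule: finite_linorder_max_induct)
  case (insert m V)
  show ?case
  proof (cases "V = {}")
    case True
    then show ?thesis by (simp add: increasing_trees_on_singleton root_degree_def harm_def)
  next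
    case False
    note IH = insert.IH[OF False]
    have mV: "m \<notin> V" using insert.hyps by blast
    obtain k where k: "card V = Suc k" using False insert.hyps(1) by (cases "card V") auto
    have ins: "\<And>F :: ltree \<Rightarrow> nat. (\<Sum>t\<in>increasing_trees_on (insert m V). F t) =
        (\<Sum>g\<in>increasing_trees_on V. \<Sum>u\<in>V. F (graft g u (leaf m)))"
      by (rule sum_insert_max) (use insert.hyps False in auto)
    have "card (increasing_trees_on (insert m V)) = card (increasing_trees_on V) * card V"
      using ins[of "\<lambda>_. 1"] by simp
    then have 1: "card (increasing_trees_on (insert m V)) = fact (card (insert m V) - 1)"
      using IH insert.hyps mV k by simp
    have "(\<Sum>t\<in>increasing_trees_on (insert m V). root_degree t) =
        (\<Sum>g\<in>increasing_trees_on V. \<Sum>u\<in>V. root_degree g + of_bool (u = Min V))"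
      unfolding ins using insert.hyps(2)
      by (intro sum.cong refl root_degree_graft_leaf) auto
    also have "\<dots> = card V * (\<Sum>g\<in>increasing_trees_on V. root_degree g) + card (increasing_trees_on V)"
      using insert.hyps(1) False
      by (simp add: sum.distrib sum_distrib_left of_bool_def sum.delta sum_Suc)
    finally have "real (\<Sum>t\<in>increasing_trees_on (insert m V). root_degree t) =
        real (card V) * (fact (card V - 1) * harm (card V - 1)) + fact (card V - 1)"
      using IH by (metis of_nat_add of_nat_fact of_nat_mult)
    also have "\<dots> = fact (Suc k) * harm (Suc k)"
      unfolding k by (simp add: harm_Suc field_simps)
    finally show ?thesis using 1 insert.hyps mV k by simp
  qed
qed simp

lemmas card_increasing_trees_on = card_and_root_degrees[THEN conjunct1]
lemmas sum_root_degree = card_and_root_degrees[THEN conjunct2]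

text \<open>Every vertex other than the root is the child in exactly one edge.\<close>

lemma card_edges_increasing_tree:
  assumes t: "t \<in> increasing_trees_on V"
  shows "card (edges t) = card V - 1"
proof -
  note tD = increasing_trees_onD[OF t]
  have "bij_betw snd (edges t) (V - {Min V})"
  proof (rule bij_betw_imageI)
    have neq: "v \<noteq> Min V" if "(u, v) \<in> edges t" for u v
      using tD(6)[OF that] tD(1) by (meson Min_le leD)
    show "inj_on snd (edges t)"
    proof (rule inj_onI)
      fix e f assume ef: "e \<in> edges t" "f \<in> edges t" "snd e = snd f"
      obtain a b c where [simp]: "e = (a, b)" "f = (c, b)" using ef(3) by (cases e, cases f) auto
      show "e = f" using ef tD(7)[of b] neq[of a b] tD(6)[of a b] by auto
    qed
    show "snd ` edges t = V - {Min V}"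
      using tD(6,7) neq by (force simp: image_iff)
  qed
  then have "card (edges t) = card (V - {Min V})" by (rule bij_betw_same_card)
  then show ?thesis using tD(1,2) by simp
qed

text \<open>The key bijection.  An edge at the root erases the tree.  Any other edge \<open>e\<close> starts at some vertex
\<open>v\<close>, and the pair consisting of the tree and \<open>e\<close> amounts to the label set \<open>D\<close> of the removed subtree
\<open>s\<close>, the parent \<open>u < Min D\<close> of \<open>v\<close>, the edge \<open>e\<close> as an edge at the root of \<open>s\<close>, and the surviving
tree \<open>g\<close>.  Given \<open>D\<close> these are chosen independently.  In particular every \<open>g\<close> on the remaining labels
is hit equally often: given its label set, the surviving tree is uniform.\<close>

lemma sum_root_part:
  fixes F :: "ltree \<Rightarrow> real"
  assumes V: "finite V" "V \<noteq> {}"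
  shows "(\<Sum>t\<in>increasing_trees_on V. \<Sum>e\<in>edges t. F (root_part t e)) =
    (\<Sum>t\<in>increasing_trees_on V. root_degree t) * F empty_tree +
    (\<Sum>D\<in>Pow (V - {Min V}) - {{}}. card {u \<in> V. u < Min D} *
       (\<Sum>s\<in>increasing_trees_on D. root_degree s) * (\<Sum>g\<in>increasing_trees_on (V - D). F g))"
proof -
  let ?IT = increasing_trees_on
  let ?Ds = "Pow (V - {Min V}) - {{}}"
  let ?R = "\<lambda>t. {e \<in> edges t. fst e = root t}" and ?N = "\<lambda>t. {e \<in> edges t. fst e \<noteq> root t}"
  let ?B = "SIGMA D:?Ds. {u \<in> V. u < Min D} \<times> (SIGMA s:?IT D. ?R s) \<times> ?IT (V - D)"
  let ?i = "\<lambda>(D, u, (s, e), g). (graft g u s, e)"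
  let ?j = "\<lambda>(t, e). (verts (subtree_at t (fst e)), parent t (fst e), (subtree_at t (fst e), e), root_part t e)"
  have at_root: "(\<Sum>e\<in>?R t. F (root_part t e)) = root_degree t * F empty_tree" for t
    by (simp add: root_part_def root_degree_def)
  have fin_edges: "finite (edges t)" if "t \<in> ?IT W" for t W using increasing_trees_onD(9)[OF that] .
  have "(\<Sum>t\<in>?IT V. \<Sum>e\<in>?N t. F (root_part t e)) = (\<Sum>(t, e)\<in>(SIGMA t:?IT V. ?N t). F (root_part t e))"
    by (rule sum.Sigma) (auto simp: fin_edges)
  also have "\<dots> = (\<Sum>(D, u, (s, e), g)\<in>?B. F g)"
  proof (rule sum.reindex_bij_witness[
where i = ?i and j = ?j])
    fix te assume "te \<in> (SIGMA t:?IT V. ?N t)"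
    then obtain t v w where te: "te = (t, (v, w))" and t: "t \<in> ?IT V" and e: "(v, w) \<in> edges t"
      and vr: "v \<noteq> Min V" using increasing_trees_onD(5) by (cases te) fastforce
    have v: "v \<in> V" using increasing_trees_onD(6)[OF t e] by simp
    let ?s = "subtree_at t v"
    have s: "?s \<in> ?IT (verts ?s)" using subtree_at_in_increasing_trees_on[OF t v vr] .
    then have "root ?s = v" "verts ?s \<noteq> {}"
      using increasing_trees_onD(2,5)[OF s] Min_subtree_at[OF t v vr] by auto
    then show "?j te \<in> ?B"
      using te s verts_subtree_at_subset[OF t v vr] Min_subtree_at[OF t v vr] parent_mem[OF t v vr]
        parent_less[OF t v vr] root_part_in_increasing_trees_on[OF t v vr]
        edges_from_subtree_at[OF t v vr e] by auto
    show "?i (?j te) = te"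
      using te graft_root_part_subtree_at[OF t v vr] by simp
  next
    fix b assume "b \<in> ?B"
    then obtain D u s e g where b: "b = (D, u, (s, e), g)" and D: "D \<subseteq> V - {Min V}"
      and u: "u \<in> V" "u < Min D" and s: "s \<in> ?IT D" and e: "e \<in> edges s" "fst e = root s"
      and g: "g \<in> ?IT (V - D)" by auto
    note lems = graft_in_increasing_trees_on[OF g s D u] subtree_at_graft[OF g s D u]
      parent_graft[OF g s D u] root_part_graft[OF g s D u]
    have ev: "fst e = Min D" "verts s = D" using e increasing_trees_onD(3,5)[OF s] by auto
    then obtain w where ew: "e = (Min D, w)" by (cases e) auto
    show "?j (?i b) = b"
      using b lems ev ew by simp
    have "Min D \<in> D" using increasing_trees_onD(1,2)[OF s] by simp
    then show "?i b \<in> (SIGMA t:?IT V. ?N t)"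
      using b lems(1) ew e(1) D increasing_trees_onD(5)[OF lems(1)] by (auto simp: graft_def)
  qed auto
  also have "\<dots> = (\<Sum>D\<in>?Ds. \<Sum>(u, (s, e), g)\<in>{u \<in> V. u < Min D} \<times> (SIGMA s:?IT D. ?R s) \<times> ?IT (V - D). F g)"
    by (rule sum.Sigma[symmetric]) (use V fin_edges in \<open>auto intro!: finite_SigmaI\<close>)
  also have "\<dots> = (\<Sum>D\<in>?Ds. card {u \<in> V. u < Min D} *
       (\<Sum>s\<in>?IT D. root_degree s) * (\<Sum>g\<in>?IT (V - D). F g))"
  proof (rule sum.cong[OF refl])
    fix D
    have "card (SIGMA s:?IT D. ?R s) = (\<Sum>s\<in>?IT D. root_degree s)"
      unfolding root_degree_def by (rule card_SigmaI) (auto simp: fin_edges)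
    moreover have "(\<Sum>(u, p, g)\<in>A \<times> B \<times> C. F g) = card A * card B * (\<Sum>g\<in>C. F g)"
      for A :: "nat set" and B :: "(ltree \<times> nat \<times> nat) set" and C
      by (simp add: sum.cartesian_product[symmetric])
    ultimately show "(\<Sum>(u, (s, e), g)\<in>{u \<in> V. u < Min D} \<times> (SIGMA s:?IT D. ?R s) \<times> ?IT (V - D). F g) =
        card {u \<in> V. u < Min D} * (\<Sum>s\<in>?IT D. root_degree s) * (\<Sum>g\<in>?IT (V - D). F g)"
      by (simp only: case_prod_unfold)
  qed
  finally have non_root: "(\<Sum>t\<in>?IT V. \<Sum>e\<in>?N t. F (root_part t e)) = \<dots>" .
  have "(\<Sum>e\<in>edges t. F (root_part t e)) =
      (\<Sum>e\<in>?R t. F (root_part t e)) + (\<Sum>e\<in>?N t. F (root_part t e))" if "t \<in> ?IT V" for t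
    using fin_edges[OF that] by (subst sum.union_disjoint[symmetric]) (auto intro!: sum.cong)
  then show ?thesis
    using non_root by (simp add: at_root sum.distrib sum_distrib_right)
qed

text \<open>Adding \<open>u\<close> to \<open>D\<close> produces a set with one more element whose minimum is \<open>u\<close>, and \<open>u\<close> and \<open>D\<close> can be
read off from it.\<close>

lemma sum_card_less_Min:
  fixes V :: "nat set"
  assumes V: "finite V" and k: "k \<ge> 1"
  shows "(\<Sum>D | D \<subseteq> V \<and> card D = k. card {u \<in> V. u < Min D}) = card V choose Suc k"
proof -
  let ?S = "SIGMA D:{D. D \<subseteq> V \<and> card D = k}. {u \<in> V. u < Min D}"
  have "bij_betw (\<lambda>A. (A - {Min A}, Min A)) {A. A \<subseteq> V \<and> card A = Suc k} ?S"
  proof (rule bij_betw_byWitness[where f' = "\<lambda>(D, u). insert u D"])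
    have fin: "finite A" if "A \<subseteq> V" for A using that V finite_subset by blast
    show "\<forall>A\<in>{A. A \<subseteq> V \<and> card A = Suc k}. (case (A - {Min A}, Min A) of (D, u) \<Rightarrow> insert u D) = A"

    proof
      fix A assume "A \<in> {A. A \<subseteq> V \<and> card A = Suc k}"
      then have "Min A \<in> A" using fin by (intro Min_in) auto
      then show "(case (A - {Min A}, Min A) of (D, u) \<Rightarrow> insert u D) = A" by auto
    qed
    have less: "u < d" if "u < Min D" "D \<subseteq> V" "d \<in> D" for u d D
      using that fin by (meson Min_le order_less_le_trans)
    show "\<forall>p\<in>?S. ((case p of (D, u) \<Rightarrow> insert u D) - {Min (case p of (D, u) \<Rightarrow> insert u D)},
        Min (case p of (D, u) \<Rightarrow> insert u D)) = p"
    proof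
      fix p assume "p \<in> ?S"
      then obtain D u where p: "p = (D, u)" "D \<subseteq> V" "card D = k" "u \<in> V" "u < Min D" by auto
      have "Min (insert u D) = u" using p less[of u D] fin[of D] by (intro Min_eqI) (auto intro: less_imp_le)
      moreover have "u \<notin> D" using p less[of u D u] by blast
      ultimately show "((case p of (D, u) \<Rightarrow> insert u D) - {Min (case p of (D, u) \<Rightarrow> insert u D)},
        Min (case p of (D, u) \<Rightarrow> insert u D)) = p" using p by simp
    qed
    show "(\<lambda>A. (A - {Min A}, Min A)) ` {A. A \<subseteq> V \<and> card A = Suc k} \<subseteq> ?S"
    proof
      fix p assume "p \<in> (\<lambda>A. (A - {Min A}, Min A)) ` {A. A \<subseteq> V \<and> card A = Suc k}"
      then obtain A where p: "p = (A - {Min A}, Min A)" and A: "A \<subseteq> V" "card A = Suc k" by auto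
      have "finite A" "A \<noteq> {}" using A fin by auto
      then have c: "card (A - {Min A}) = k" "Min A \<in> A" using A by auto
      then have "A - {Min A} \<noteq> {}" using k by (metis card.empty not_one_le_zero)
      then have "Min (A - {Min A}) \<in> A - {Min A}" using \<open>finite A\<close> by (intro Min_in) auto
      then have "Min A < Min (A - {Min A})" using \<open>finite A\<close>
        by (metis DiffE Min_le insertI1 le_neq_implies_less)
      then show "p \<in> ?S" using p A c by auto
    qed
    show "(\<lambda>(D, u). insert u D) ` ?S \<subseteq> {A. A \<subseteq> V \<and> card A = Suc k}"
      using less fin by (auto, metis card_insert_disjoint less_irrefl)
  qed
  then have "card ?S = card {A. A \<subseteq> V \<and> card A = Suc k}" by (rule bij_betw_same_card[symmetric])
  also have "\<dots> = card V choose Suc k" by (rule n_subsets[OF V])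
  also have "card ?S = (\<Sum>D | D \<subseteq> V \<and> card D = k. card {u \<in> V. u < Min D})"
    using V by (subst card_SigmaI) auto
  finally show ?thesis .
qed

section \<open>The recurrence for the absorption probabilities\<close>

text \<open>The probability that the chain of cuts started at the tree \<open>t\<close> has fewer than two vertices for the
first time at time \<open>j\<close>.  Time \<open>0\<close> is included; for a start with at least two vertices this makes no
difference.\<close>

primrec absorb_prob :: "nat \<Rightarrow> ltree \<Rightarrow> real" where
  "absorb_prob 0 t = of_bool (card (verts t) < 2)"
| "absorb_prob (Suc j) t =
     (if card (verts t) < 2 then 0
      else measure_pmf.expectation (degree_biased_step t) (absorb_prob j))"

definition mean_absorb_prob :: "nat \<Rightarrow> nat \<Rightarrow> real" where
  "mean_absorb_prob j n = measure_pmf.expectation (random_recursive_tree n) (absorb_prob j)"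

lemma absorb_prob_Suc_increasing_tree:
  assumes t: "t \<in> increasing_trees_on V" and n: "card V \<ge> 2"
  shows "absorb_prob (Suc j) t = (\<Sum>e\<in>edges t. absorb_prob j (root_part t e)) / real (card V - 1)"
proof -
  note c = card_edges_increasing_tree[OF t]
  have "edges t \<noteq> {}" using c n by auto
  then show ?thesis using increasing_trees_onD(3,9)[OF t] c n
    by (simp add: degree_biased_step_def degree_biased_cut_def integral_pmf_of_set)
qed

text \<open>First-step analysis, summed over all increasing trees on \<open>V\<close>.  If the sums for time \<open>j\<close> depend only
on the number of labels, then all removed sets \<open>D\<close> of the same size \<open>k\<close> contribute alike, and so
the sum for time \<open>Suc j\<close> depends only on the number of labels as well.\<close>

lemma sum_absorb_prob_Suc:
  assumes V: "finite V" "V \<noteq> {}" and n: "card V = n" "n \<ge> 2"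
    and hyp: "\<And>W. finite W \<Longrightarrow> W \<noteq> {} \<Longrightarrow> (\<Sum>g\<in>increasing_trees_on W. absorb_prob j g) = \<phi> (card W)"
  shows "(\<Sum>t\<in>increasing_trees_on V. absorb_prob (Suc j) t) =
    (fact (n - 1) * harm (n - 1) * absorb_prob j empty_tree +
     (\<Sum>k = 1..n - 1. real (n choose Suc k) * (fact (k - 1) * harm (k - 1)) * \<phi> (n - k))) / real (n - 1)"
proof -
  let ?Ds = "Pow (V - {Min V}) - {{}}" and ?c = "\<lambda>D. card {u \<in> V. u < Min D}"
  let ?w = "\<lambda>k. fact (k - 1) * harm (k - 1) * \<phi> (n - k)"
  have finD: "finite D" if "D \<subseteq> V" for D using that V finite_subset by blast
  have MinV: "Min V \<in> V" using V by simp
  have zero: "?c D = 0" if "Min V \<in> D" "D \<subseteq> V" for D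
  proof -
    have "Min D = Min V" using that finD[OF that(2)] V by (intro Min_eqI) auto
    then have "{u \<in> V. u < Min D} = {}" using V by (auto simp: not_less)
    then show ?thesis by simp
  qed
  have "(\<Sum>D\<in>?Ds. ?c D * (\<Sum>s\<in>increasing_trees_on D. root_degree s) * (\<Sum>g\<in>increasing_trees_on (V - D). absorb_prob j g)) =
      (\<Sum>D\<in>?Ds. ?c D * ?w (card D))"
  proof (rule sum.cong[OF refl])
    fix D assume D: "D \<in> ?Ds"
    then have "finite D" "D \<noteq> {}" "D \<subseteq> V" using finD by auto
    moreover have "V - D \<noteq> {}" using D MinV by auto
    moreover have "card (V - D) = n - card D" using calculation n by (simp add: card_Diff_subset)
    ultimately show "?c D * (\<Sum>s\<in>increasing_trees_on D. root_degree s) * (\<Sum>g\<in>increasing_trees_on (V - D). absorb_prob j g) =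
        ?c D * ?w (card D)"
      using sum_root_degree[of D] hyp[of "V - D"] V by simp
  qed
  \<comment> \<open>Sets containing the root label may be admitted, since no label is below their minimum.  The
    binomial count is over all \<open>k\<close>-element subsets of \<open>V\<close>.\<close>
  also have "\<dots> = (\<Sum>D\<in>{D \<in> Pow V. card D \<in> {1..n - 1}}. ?c D * ?w (card D))"
  proof (rule sum.mono_neutral_left)
    show "?Ds \<subseteq> {D \<in> Pow V. card D \<in> {1..n - 1}}"
    proof
      fix D assume D: "D \<in> ?Ds"
      then have "card D \<le> card (V - {Min V})" using V by (intro card_mono) auto
      moreover have "D \<subseteq> V" using D by auto
      then have "card D \<noteq> 0" using D finD[of D] by auto
      moreover note \<open>D \<subseteq> V\<close>
      ultimately show "D \<in> {D \<in> Pow V. card D \<in> {1..n - 1}}" using D V n MinV by auto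
    qed
    show "\<forall>D\<in>{D \<in> Pow V. card D \<in> {1..n - 1}} - ?Ds. ?c D * ?w (card D) = 0"
    proof
      fix D assume D: "D \<in> {D \<in> Pow V. card D \<in> {1..n - 1}} - ?Ds"
      then have "D \<noteq> {}" "D \<subseteq> V" by auto
      then have "Min V \<in> D" using D by auto
      then show "?c D * ?w (card D) = 0" using zero[of D] \<open>D \<subseteq> V\<close> by simp
    qed
  qed (use V in auto)
  also have "\<dots> = (\<Sum>k = 1..n - 1. \<Sum>D\<in>{D \<in> {D \<in> Pow V. card D \<in> {1..n - 1}}. card D = k}. ?c D * ?w (card D))"
    by (rule sum.group[symmetric]) (use V in auto)
  also have "\<dots> = (\<Sum>k = 1..n - 1. real (n choose Suc k) * ?w k)"
  proof (rule sum.cong[OF refl])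
    fix k assume k: "k \<in> {1..n - 1}"
    then have "{D \<in> {D \<in> Pow V. card D \<in> {1..n - 1}}. card D = k} = {D. D \<subseteq> V \<and> card D = k}" by auto
    moreover have "(\<Sum>D | D \<subseteq> V \<and> card D = k. ?c D * ?w (card D)) =
        real (\<Sum>D | D \<subseteq> V \<and> card D = k. ?c D) * ?w k"
      unfolding of_nat_sum sum_distrib_right by (rule sum.cong) auto
    ultimately show "(\<Sum>D\<in>{D \<in> {D \<in> Pow V. card D \<in> {1..n - 1}}. card D = k}. ?c D * ?w (card D)) =
        real (n choose Suc k) * ?w k"
      using sum_card_less_Min[OF V(1), of k] k n by (simp only: atLeastAtMost_iff)
  qed
  finally have "(\<Sum>t\<in>increasing_trees_on V. \<Sum>e\<in>edges t. absorb_prob j (root_part t e)) =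
      fact (n - 1) * harm (n - 1) * absorb_prob j empty_tree + \<dots>"
    using sum_root_part[OF V, of "absorb_prob j"] sum_root_degree[OF V] n by simp
  moreover have "(\<Sum>t\<in>increasing_trees_on V. absorb_prob (Suc j) t) =
      (\<Sum>t\<in>increasing_trees_on V. (\<Sum>e\<in>edges t. absorb_prob j (root_part t e)) / real (n - 1))"
    using absorb_prob_Suc_increasing_tree n by (intro sum.cong) (auto simp del: absorb_prob.simps)
  ultimately show ?thesis by (simp add: sum_divide_distrib[symmetric] mult.assoc del: absorb_prob.simps)
qed

lemma mean_absorb_prob_eq:
  assumes "n \<ge> 1"
  shows "mean_absorb_prob j n = (\<Sum>t\<in>increasing_trees_on {1..n}. absorb_prob j t) / fact (n - 1)"
  using assms increasing_trees_on_nonempty[of n]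
  by (simp add: mean_absorb_prob_def random_recursive_tree_def integral_pmf_of_set
      card_increasing_trees_on)

text \<open>The cut leaves a tree on some subset of the labels rather than on an initial segment.  The previous
recursion holds for every label set and refers to it only through its size, so induction on \<open>j\<close>
shows that the labels do not matter, without relabelling any tree.\<close>

lemma sum_absorb_prob:
  assumes "finite V" "V \<noteq> {}"
  shows "(\<Sum>t\<in>increasing_trees_on V. absorb_prob j t) = fact (card V - 1) * mean_absorb_prob j (card V)"
proof -
  have *: "(\<Sum>t\<in>increasing_trees_on V. absorb_prob j t) =
      (\<Sum>t\<in>increasing_trees_on {1..card V}. absorb_prob j t)"
    using assms
  proof (induction j arbitrary: V)
    case 0
    have "(\<Sum>t\<in>increasing_trees_on W. absorb_prob 0 t) = fact (card W - 1) * of_bool (card W < 2)"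
      if "finite W" "W \<noteq> {}" for W
      using that increasing_trees_onD(3)[of _ W] by (simp add: card_increasing_trees_on)
    from this[OF 0] this[of "{1..card V}"] 0 show ?case by (auto simp: card_gt_0_iff Suc_le_eq)
  next
    case (Suc j)
    have ne: "card V \<ge> 1" using Suc.prems by (simp add: Suc_le_eq card_gt_0_iff)
    show ?case
    proof (cases "card V = 1")
      case True
      have "(\<Sum>t\<in>increasing_trees_on W. absorb_prob (Suc j) t) = 0" if "card W = 1" for W
        using that increasing_trees_onD(3)[of _ W] by (intro sum.neutral) auto
      then show ?thesis using True by (simp del: absorb_prob.simps)
    next
      case False
      then have n: "card V \<ge> 2" using ne by simp
      show ?thesis
        using sum_absorb_prob_Suc[OF Suc.prems refl n Suc.IH]
          sum_absorb_prob_Suc[of "{1..card V}" "card V", OF _ _ _ n Suc.IH] n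
        by (simp del: absorb_prob.simps)
    qed
  qed
  show ?thesis
    using * mean_absorb_prob_eq[of "card V" j] assms by (simp add: Suc_le_eq card_gt_0_iff)
qed

text \<open>Division of the counts by the \<open>(n - 1)!\<close> trees and the \<open>n - 1\<close> edges of each.  The coefficient of
\<open>mean_absorb_prob j (n - k)\<close> is
\<open>(n choose (k + 1)) (k - 1)! H\<^sub>k\<^sub>-\<^sub>1 (n - k - 1)! / ((n - 1)! (n - 1))\<close>, that is, the probability that
the cut removes \<open>k\<close> vertices and leaves a nonempty tree.\<close>

lemma mean_absorb_prob_Suc:
  assumes n: "n \<ge> 2"
  shows "mean_absorb_prob (Suc j) n =
    harm (n - 1) / (real n - 1) * absorb_prob j empty_tree +
    (\<Sum>k = 1..n - 1. real n * harm (k - 1) / (real k * real (k + 1) * (real n - 1)) *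
       mean_absorb_prob j (n - k))"
proof -
  have coeff: "real (n choose Suc k) * (fact (k - 1) * harm (k - 1)) *
      (fact (n - k - 1) * mean_absorb_prob j (n - k)) / real (n - 1) / fact (n - 1) =
      real n * harm (k - 1) / (real k * real (k + 1) * (real n - 1)) * mean_absorb_prob j (n - k)"
    if k: "k \<in> {1..n - 1}" for k
  proof -
    \<comment> \<open>The factorials cancel; here \<open>a\<close>, \<open>b\<close>, \<open>c\<close> stand for \<open>(n - 1)!\<close>, \<open>(k - 1)!\<close>, \<open>(n - k - 1)!\<close>.\<close>
    have cancel: "x * a / ((y + 1) * (y * b) * c) * (b * h) * (c * p) / d / a = x * h / (y * (y + 1) * d) * p"
      if "a > 0" "b > 0" "c > 0" "y > 0" for a b c d h p x y :: real
      using that by (simp add: divide_simps)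
    have "fact n = real n * fact (n - 1)" "(fact (Suc k) :: real) = (real k + 1) * (real k * fact (k - 1))"
      using n k fact_reduce[of k, where 'a = real] by (auto simp: fact_reduce[of n] algebra_simps)
    then have "real (n choose Suc k) =
        real n * fact (n - 1) / ((real k + 1) * (real k * fact (k - 1)) * fact (n - k - 1))"
      using k n by (subst binomial_fact) auto
    then show ?thesis using n k by (simp add: cancel) (simp add: mult_ac add_ac)
  qed
  have "(\<Sum>t\<in>increasing_trees_on {1..n}. absorb_prob (Suc j) t) =
    (fact (n - 1) * harm (n - 1) * absorb_prob j empty_tree +
     (\<Sum>k = 1..n - 1. real (n choose Suc k) * (fact (k - 1) * harm (k - 1)) *
        (fact (n - k - 1) * mean_absorb_prob j (n - k)))) / real (n - 1)"
    using n by (intro sum_absorb_prob_Suc[of _ n] sum_absorb_prob) auto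
  then have "mean_absorb_prob (Suc j) n =
    (fact (n - 1) * harm (n - 1) * absorb_prob j empty_tree +
     (\<Sum>k = 1..n - 1. real (n choose Suc k) * (fact (k - 1) * harm (k - 1)) *
        (fact (n - k - 1) * mean_absorb_prob j (n - k)))) / real (n - 1) / fact (n - 1)"
    using mean_absorb_prob_eq[of n "Suc j"] n by (simp del: absorb_prob.simps)
  also have "\<dots> = harm (n - 1) / (real n - 1) * absorb_prob j empty_tree +
    (\<Sum>k = 1..n - 1. real (n choose Suc k) * (fact (k - 1) * harm (k - 1)) *
        (fact (n - k - 1) * mean_absorb_prob j (n - k)) / real (n - 1) / fact (n - 1))"
    using n by (simp add: add_divide_distrib sum_divide_distrib)
  also have "\<dots> = harm (n - 1) / (real n - 1) * absorb_prob j empty_tree +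
    (\<Sum>k = 1..n - 1. real n * harm (k - 1) / (real k * real (k + 1) * (real n - 1)) *
       mean_absorb_prob j (n - k))"
    using coeff by simp
  finally show ?thesis .
qed

lemma mean_absorb_prob_one_vertex: "mean_absorb_prob j 1 = of_bool (j = 0)"
  using mean_absorb_prob_eq[of 1 j] by (cases j) (simp_all add: increasing_trees_on_singleton)

lemma mean_absorb_prob_0:
  assumes "n \<ge> 1"
  shows "mean_absorb_prob 0 n = of_bool (n = 1)"
proof -
  have "(\<Sum>t\<in>increasing_trees_on {1..n}. absorb_prob 0 t) = fact (n - 1) * of_bool (n < 2)"
    using increasing_trees_onD(3)[of _ "{1..n}"] assms by (simp add: card_increasing_trees_on)
  then show ?thesis using assms by (auto simp: mean_absorb_prob_eq simp del: absorb_prob.simps)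
qed

text \<open>One cut suffices if the chosen edge is at the root, or if it removes all vertices but the root, the
term \<open>k = n - 1\<close>.\<close>

lemma mean_absorb_prob_1:
  assumes n: "n \<ge> 2"
  shows "mean_absorb_prob 1 n = harm (n - 2) / (real n - 1)\<^sup>2 + harm (n - 1) / (real n - 1)"
proof -
  have "(\<Sum>k = 1..n - 1. real n * harm (k - 1) / (real k * real (k + 1) * (real n - 1)) *
       mean_absorb_prob 0 (n - k)) =
    (\<Sum>k = 1..n - 1. if k = n - 1 then real n * harm (k - 1) / (real k * real (k + 1) * (real n - 1)) else 0)"
    by (rule sum.cong) (auto simp: mean_absorb_prob_0)
  also have "\<dots> = harm (n - 2) / (real n - 1)\<^sup>2"
    using n by (simp add: power2_eq_square of_nat_diff numeral_2_eq_2)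
  finally show ?thesis using mean_absorb_prob_Suc[OF n, of 0] by (simp add: empty_tree_def)
qed

text \<open>The term \<open>k = n - 1\<close> drops out because a single vertex is already absorbed, the term \<open>k = 1\<close>
because a removed subtree contains both ends of the chosen edge, which shows here as \<open>H\<^sub>0 = 0\<close>.\<close>

lemma mean_absorb_prob_Suc_Suc:
  assumes n: "n \<ge> 2"
  shows "mean_absorb_prob (Suc (Suc j)) n =
    (\<Sum>k = 2..n - 2. real n * harm (k - 1) / (real k * real (k + 1) * (real n - 1)) *
       mean_absorb_prob (Suc j) (n - k))"
proof -
  have "(\<Sum>k = 1..n - 1. real n * harm (k - 1) / (real k * real (k + 1) * (real n - 1)) *
       mean_absorb_prob (Suc j) (n - k)) =
    (\<Sum>k = 2..n - 2. real n * harm (k - 1) / (real k * real (k + 1) * (real n - 1)) *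
       mean_absorb_prob (Suc j) (n - k))"
  proof (rule sum.mono_neutral_right)
    show "\<forall>k\<in>{1..n - 1} - {2..n - 2}. real n * harm (k - 1) / (real k * real (k + 1) * (real n - 1)) *
       mean_absorb_prob (Suc j) (n - k) = 0"
    proof
      fix k assume "k \<in> {1..n - 1} - {2..n - 2}"
      then have "k = 1 \<or> n - k = 1" using n by auto
      then show "real n * harm (k - 1) / (real k * real (k + 1) * (real n - 1)) *
       mean_absorb_prob (Suc j) (n - k) = 0"
        using mean_absorb_prob_one_vertex[of "Suc j"] by (auto simp: harm_def)
    qed
  qed auto
  then show ?thesis using mean_absorb_prob_Suc[OF n, of "Suc j"] by (simp add: empty_tree_def)
qed

text \<open>The chain loses a vertex in each cut, so a start with at most \<open>m + 1\<close> vertices is absorbed by time \<open>m\<close>.\<close>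

lemma sum_absorb_prob_eq_1:
  assumes "t = empty_tree \<or> increasing_tree t" "card (verts t) \<le> Suc m"
  shows "(\<Sum>j\<le>m. absorb_prob j t) = 1"
  using assms
proof (induction m arbitrary: t)
  case 0
  then show ?case by simp
next
  case (Suc m)
  show ?case
  proof (cases "card (verts t) < 2")
    case True
    then have "absorb_prob j t = of_bool (j = 0)" for j by (cases j) auto
    then show ?thesis by simp
  next
    case False
    define V where "V = verts t"
    have t: "t \<in> increasing_trees_on V"
      using Suc.prems False by (auto simp: increasing_trees_on_def V_def empty_tree_def)
    have n: "card V \<ge> 2" using False by (simp add: V_def)
    have "(\<Sum>j\<le>m. absorb_prob j (root_part t e)) = 1" if e: "e \<in> edges t" for e
      using Suc.prems(2) root_part_increasing_or_empty[OF t e] card_verts_root_part_less[OF t e]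
      by (intro Suc.IH) (auto simp: V_def)
    then have "(\<Sum>e\<in>edges t. \<Sum>j\<le>m. absorb_prob j (root_part t e)) = real (card V - 1)"
      using card_edges_increasing_tree[OF t] by simp
    then have "(\<Sum>j\<le>m. absorb_prob (Suc j) t) = 1"
      using n absorb_prob_Suc_increasing_tree[OF t n]
      by (simp add: sum_divide_distrib[symmetric] sum.swap[of _ "edges t"] del: absorb_prob.simps)
    then show ?thesis using False by (subst sum.atMost_Suc_shift) simp
  qed
qed

section \<open>From the process to the absorption probabilities\<close>

text \<open>Time is counted from \<open>t\<close> on, so that a first step from time \<open>t\<close> leaves an event of the same form
from time \<open>Suc t\<close>.\<close>

definition absorbed_after :: "nat \<Rightarrow> nat \<Rightarrow> (nat \<Rightarrow> 'a \<Rightarrow> ltree) \<Rightarrow> 'a \<Rightarrow> bool" where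
  "absorbed_after t j G \<omega> \<longleftrightarrow>
     (\<forall>s. t \<le> s \<and> s < t + j \<longrightarrow> card (verts (G s \<omega>)) \<ge> 2) \<and> card (verts (G (t + j) \<omega>)) < 2"

lemma absorbed_after_0: "absorbed_after t 0 G \<omega> \<longleftrightarrow> card (verts (G t \<omega>)) < 2"
  by (auto simp: absorbed_after_def)

lemma absorbed_after_Suc:
  "absorbed_after t (Suc j) G \<omega> \<longleftrightarrow> card (verts (G t \<omega>)) \<ge> 2 \<and> absorbed_after (Suc t) j G \<omega>"
proof -
  have "(\<forall>s. t \<le> s \<and> s < t + Suc j \<longrightarrow> P s) \<longleftrightarrow> P t \<and> (\<forall>s. Suc t \<le> s \<and> s < Suc t + j \<longrightarrow> P s)" for P
    by (auto simp: Suc_le_eq) (metis le_neq_implies_less)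
  then show ?thesis by (simp add: absorbed_after_def)
qed

lemma absorbed_after_unique:
  assumes "absorbed_after t i G \<omega>" "absorbed_after t j G \<omega>"
  shows "i = j"
proof -
  have "\<not> i < j" if "absorbed_after t i G \<omega>" "absorbed_after t j G \<omega>" for i j
  proof
    assume "i < j"
    then have "2 \<le> card (verts (G (t + i) \<omega>))" using that(2) by (auto simp: absorbed_after_def)
    then show False using that(1) by (simp add: absorbed_after_def)
  qed
  then show ?thesis using assms by (metis linorder_neqE_nat)
qed

text \<open>Splitting an event \<open>A\<close> according to the outcome \<open>x\<close> of a step whose law given \<open>A\<close> is \<open>p\<close>.  The
type of \<open>x\<close> may be uncountable, so the part of \<open>A\<close> with an outcome outside the finite support of \<open>p\<close>
is not summed over but shown to be null, since the outcomes in the support already exhaust the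
probability of \<open>A\<close>.\<close>

lemma (in prob_space) prob_eq_sum_finite_support:
  assumes fin: "finite (set_pmf p)" and A: "{\<omega> \<in> space M. A \<omega>} \<in> events"
    and E: "\<And>x. {\<omega> \<in> space M. E x \<omega>} \<in> events"
    and disj: "\<And>x y \<omega>. E x \<omega> \<Longrightarrow> E y \<omega> \<Longrightarrow> x = y"
    and E_le: "\<And>x \<omega>. E x \<omega> \<Longrightarrow> A \<omega>"
    and pr: "\<And>x. \<P>(\<omega> in M. E x \<omega>) = \<P>(\<omega> in M. A \<omega>) * pmf p x"
    and B: "{\<omega> \<in> space M. B \<omega>} \<in> events"
  shows "\<P>(\<omega> in M. A \<omega> \<and> B \<omega>) = (\<Sum>x\<in>set_pmf p. \<P>(\<omega> in M. E x \<omega> \<and> B \<omega>))"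
proof -
  let ?U = "\<Union>x\<in>set_pmf p. {\<omega> \<in> space M. E x \<omega>}"
  have "prob ?U = (\<Sum>x\<in>set_pmf p. \<P>(\<omega> in M. E x \<omega>))"
    using fin E disj by (intro finite_measure_finite_Union) (auto simp: disjoint_family_on_def)
  also have "\<dots> = \<P>(\<omega> in M. A \<omega>)"
    unfolding pr sum_distrib_left[symmetric] using fin by (simp add: sum_pmf_eq_1)
  finally have U: "prob ?U = \<P>(\<omega> in M. A \<omega>)" .
  have "prob ({\<omega> \<in> space M. A \<omega>} - ?U) = 0"
    using U A E fin E_le by (subst finite_measure_Diff) (auto intro!: sets.finite_UN)
  moreover have D: "{\<omega> \<in> space M. A \<omega>} - ?U \<in> events"
    using A E fin by (intro sets.Diff sets.finite_UN) auto
  ultimately have null: "{\<omega> \<in> space M. A \<omega>} - ?U \<in> null_sets M"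
    by (simp add: null_sets_def emeasure_eq_measure)
  have AB: "{\<omega> \<in> space M. A \<omega> \<and> B \<omega>} \<in> events" using sets.sets_Collect_conj[OF B A] .
  have EB: "{\<omega> \<in> space M. E x \<omega> \<and> B \<omega>} \<in> events" for x using sets.sets_Collect_conj[OF B E] .
  have "\<P>(\<omega> in M. A \<omega> \<and> B \<omega>) = prob (\<Union>x\<in>set_pmf p. {\<omega> \<in> space M. E x \<omega> \<and> B \<omega>})"
  proof (rule finite_measure_eq_AE)
    show "AE \<omega> in M. \<omega> \<in> {\<omega> \<in> space M. A \<omega> \<and> B \<omega>} \<longleftrightarrow> \<omega> \<in> (\<Union>x\<in>set_pmf p. {\<omega> \<in> space M. E x \<omega> \<and> B \<omega>})"
      using AE_not_in[OF null] by eventually_elim (use E_le in auto)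
  qed (use AB EB fin in \<open>auto intro!: sets.finite_UN\<close>)
  also have "\<dots> = (\<Sum>x\<in>set_pmf p. \<P>(\<omega> in M. E x \<omega> \<and> B \<omega>))"
    using fin EB disj by (intro finite_measure_finite_Union) (auto simp: disjoint_family_on_def)
  finally show ?thesis .
qed

locale cut_process = prob_space M for M :: "'a measure" +
  fixes n :: nat and G :: "nat \<Rightarrow> 'a \<Rightarrow> ltree"
  assumes process: "degree_biased_process n M G" and n: "n \<ge> 2"
begin

lemma measurable_G [measurable]: "G t \<in> M \<rightarrow>\<^sub>M count_space UNIV"
  using process by (simp add: degree_biased_process_def)

lemma G_eq_event [measurable]: "Measurable.pred M (\<lambda>\<omega>. G t \<omega> = g)"
  by measurable

lemma card_G_event [measurable]: "Measurable.pred M (\<lambda>\<omega>. P (card (verts (G t \<omega>))))"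
  by (rule measurable_compose[OF measurable_G]) simp

lemma absorbed_after_event [measurable]: "Measurable.pred M (absorbed_after t j G)"
  unfolding absorbed_after_def[abs_def] by measurable

text \<open>The Markov property, in the form in which the process is given: conditionally on a full history, the
absorption time depends only on the current tree.  Induction on \<open>j\<close>, extending the history by one
step.\<close>

lemma prob_history_absorbed_after:
  assumes "h t = empty_tree \<or> increasing_tree (h t)"
  shows "\<P>(\<omega> in M. (\<forall>s\<le>t. G s \<omega> = h s) \<and> absorbed_after t j G \<omega>) =
    \<P>(\<omega> in M. \<forall>s\<le>t. G s \<omega> = h s) * absorb_prob j (h t)"
  using assms
proof (induction j arbitrary: t h)
  case 0
  have "((\<forall>s\<le>t. G s \<omega> = h s) \<and> absorbed_after t 0 G \<omega>) \<longleftrightarrow>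
      (\<forall>s\<le>t. G s \<omega> = h s) \<and> card (verts (h t)) < 2" for \<omega>
    by (auto simp: absorbed_after_0)
  then show ?case by simp
next
  case (Suc j)
  show ?case
  proof (cases "card (verts (h t)) < 2")
    case True
    have *: "((\<forall>s\<le>t. G s \<omega> = h s) \<and> absorbed_after t (Suc j) G \<omega>) \<longleftrightarrow> False" for \<omega>
      using True by (auto simp: absorbed_after_Suc)
    show ?thesis using True unfolding * by simp
  next
    case False
    then have inc: "increasing_tree (h t)" using Suc.prems by (auto simp: empty_tree_def)
    define V where "V = verts (h t)"
    have hV: "h t \<in> increasing_trees_on V" using inc by (simp add: V_def increasing_trees_on_def)
    have edges: "finite (edges (h t))" "edges (h t) \<noteq> {}"
      using increasing_trees_onD(9)[OF hV] card_edges_increasing_tree[OF hV] False by (auto simp: V_def)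
    let ?p = "degree_biased_step (h t)"
    have set_p: "set_pmf ?p = root_part (h t) ` edges (h t)"
      using False edges by (simp add: degree_biased_step_def degree_biased_cut_def)
    have hist: "((\<forall>s\<le>t. G s \<omega> = h s) \<and> G (Suc t) \<omega> = g) \<longleftrightarrow>
        (\<forall>s\<le>Suc t. G s \<omega> = (h(Suc t := g)) s)" for g \<omega>
      by (auto simp: le_Suc_eq)
    have split: "((\<forall>s\<le>t. G s \<omega> = h s) \<and> absorbed_after t (Suc j) G \<omega>) \<longleftrightarrow>
        (\<forall>s\<le>t. G s \<omega> = h s) \<and> absorbed_after (Suc t) j G \<omega>" for \<omega>
      using False by (auto simp: absorbed_after_Suc)
    have step: "\<P>(\<omega> in M. (\<forall>s\<le>t. G s \<omega> = h s) \<and> G (Suc t) \<omega> = g) =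
        \<P>(\<omega> in M. \<forall>s\<le>t. G s \<omega> = h s) * pmf ?p g" for g
      using process by (simp add: degree_biased_process_def)
    have "\<P>(\<omega> in M. (\<forall>s\<le>t. G s \<omega> = h s) \<and> absorbed_after (Suc t) j G \<omega>) =
        (\<Sum>g\<in>set_pmf ?p. \<P>(\<omega> in M. ((\<forall>s\<le>t. G s \<omega> = h s) \<and> G (Suc t) \<omega> = g) \<and> absorbed_after (Suc t) j G \<omega>))"
      by (rule prob_eq_sum_finite_support) (use set_p edges step in auto)
    also have "\<dots> = (\<Sum>g\<in>set_pmf ?p. \<P>(\<omega> in M. \<forall>s\<le>t. G s \<omega> = h s) * pmf ?p g * absorb_prob j g)"
    proof (rule sum.cong[OF refl])
      fix g assume "g \<in> set_pmf ?p"
      then have "g = empty_tree \<or> increasing_tree g"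
        using root_part_increasing_or_empty[OF hV] set_p by auto
      then show "\<P>(\<omega> in M. ((\<forall>s\<le>t. G s \<omega> = h s) \<and> G (Suc t) \<omega> = g) \<and> absorbed_after (Suc t) j G \<omega>) =
          \<P>(\<omega> in M. \<forall>s\<le>t. G s \<omega> = h s) * pmf ?p g * absorb_prob j g"
        using Suc.IH[of "h(Suc t := g)" "Suc t"] step[of g] unfolding hist by simp
    qed
    also have "\<dots> = \<P>(\<omega> in M. \<forall>s\<le>t. G s \<omega> = h s) * measure_pmf.expectation ?p (absorb_prob j)"
      using set_p edges by (subst integral_measure_pmf_real[of "set_pmf ?p"])
        (auto simp: sum_distrib_left sum_distrib_right mult_ac)
    finally show ?thesis using False unfolding split by simp
  qed
qed

lemma prob_absorbed_after: "\<P>(\<omega> in M. absorbed_after 0 j G \<omega>) = mean_absorb_prob j n"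
proof -
  let ?p = "random_recursive_tree n"
  have set_p: "set_pmf ?p = increasing_trees_on {1..n}"
    using n increasing_trees_on_nonempty[of n] by (simp add: random_recursive_tree_def)
  have init: "\<P>(\<omega> in M. G 0 \<omega> = g) = pmf ?p g" for g
  proof -
    have "\<P>(\<omega> in M. G 0 \<omega> = g) = measure (distr M (count_space UNIV) (G 0)) {g}"
      by (subst measure_distr) (auto intro: arg_cong[of _ _ prob])
    also have "\<dots> = pmf ?p g"
      using process by (simp add: degree_biased_process_def measure_pmf_single)
    finally show ?thesis .
  qed
  have "\<P>(\<omega> in M. True \<and> absorbed_after 0 j G \<omega>) =
      (\<Sum>g\<in>set_pmf ?p. \<P>(\<omega> in M. G 0 \<omega> = g \<and> absorbed_after 0 j G \<omega>))"
    by (rule prob_eq_sum_finite_support) (use set_p init prob_space in auto)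
  also have "\<dots> = (\<Sum>g\<in>set_pmf ?p. pmf ?p g * absorb_prob j g)"
    using prob_history_absorbed_after[of "\<lambda>_. _" 0 j] init set_p
    by (intro sum.cong) (auto simp: increasing_trees_on_def)
  also have "\<dots> = mean_absorb_prob j n"
    unfolding mean_absorb_prob_def
    using set_p by (subst integral_measure_pmf_real[of "set_pmf ?p"]) (auto simp: mult_ac)
  finally show ?thesis by simp
qed

text \<open>The absorption probabilities for the times up to \<open>n\<close> add up to one, for each tree and hence in the mean,
and a trajectory is absorbed at only one time.\<close>

lemma AE_absorbed: "AE \<omega> in M. \<exists>j\<in>{1..n}. absorbed_after 0 j G \<omega>"
proof -
  have "\<P>(\<omega> in M. \<exists>j\<in>{..n}. absorbed_after 0 j G \<omega>) = (\<Sum>j\<le>n. mean_absorb_prob j n)"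
  proof -
    have "{\<omega> \<in> space M. \<exists>j\<in>{..n}. absorbed_after 0 j G \<omega>} = (\<Union>j\<in>{..n}. {\<omega> \<in> space M. absorbed_after 0 j G \<omega>})"
      by auto
    also have "prob \<dots> = (\<Sum>j\<le>n. \<P>(\<omega> in M. absorbed_after 0 j G \<omega>))"
      by (intro finite_measure_finite_Union) (auto simp: disjoint_family_on_def dest: absorbed_after_unique)
    finally show ?thesis by (simp add: prob_absorbed_after)
  qed
  also have "\<dots> = (\<Sum>t\<in>increasing_trees_on {1..n}. \<Sum>j\<le>n. absorb_prob j t) / fact (n - 1)"
    using n by (simp add: mean_absorb_prob_eq sum_divide_distrib[symmetric] sum.swap[of _ "{..n}"])
  also have "(\<Sum>t\<in>increasing_trees_on {1..n}. \<Sum>j\<le>n. absorb_prob j t) =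
      (\<Sum>t\<in>increasing_trees_on {1..n}. 1)"
    by (intro sum.cong sum_absorb_prob_eq_1) (auto simp: increasing_trees_on_def)
  finally have "\<P>(\<omega> in M. \<exists>j\<in>{..n}. absorbed_after 0 j G \<omega>) = 1"
    using n by (simp add: card_increasing_trees_on)
  then have "AE \<omega> in M. \<exists>j\<in>{..n}. absorbed_after 0 j G \<omega>"
    by (subst (asm) prob_Collect_eq_1) auto
  moreover have "\<P>(\<omega> in M. absorbed_after 0 0 G \<omega>) = 0"
    using prob_absorbed_after[of 0] mean_absorb_prob_0[of n] n by simp
  then have "AE \<omega> in M. \<not> absorbed_after 0 0 G \<omega>"
    by (subst (asm) prob_Collect_eq_0) auto
  ultimately show ?thesis
    by eventually_elim (metis atLeastAtMost_iff atMost_iff less_one not_less)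
qed

lemma prob_num_cuts:
  assumes "j \<ge> 1"
  shows "\<P>(\<omega> in M. num_cuts n G \<omega> = j) = mean_absorb_prob j n"
proof -
  have stop: "card (verts (G t \<omega>)) \<in> {0, 1} \<longleftrightarrow> card (verts (G t \<omega>)) < 2" for t \<omega> by auto
  have num: "num_cuts n G \<omega> = (LEAST t. 1 \<le> t \<and> card (verts (G t \<omega>)) < 2)" for \<omega>
    unfolding num_cuts_def stop using n by simp
  have "\<P>(\<omega> in M. num_cuts n G \<omega> = j) = \<P>(\<omega> in M. absorbed_after 0 j G \<omega>)"
  proof (rule finite_measure_eq_AE)
    show "AE \<omega> in M. \<omega> \<in> {\<omega> \<in> space M. num_cuts n G \<omega> = j} \<longleftrightarrow> \<omega> \<in> {\<omega> \<in> space M. absorbed_after 0 j G \<omega>}"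
      using AE_absorbed AE_space
    proof eventually_elim
      case (elim \<omega>)
      then obtain i where i: "i \<ge> 1" "absorbed_after 0 i G \<omega>" by auto
      then have before: "\<And>s. s < i \<Longrightarrow> 2 \<le> card (verts (G s \<omega>))" and at: "card (verts (G i \<omega>)) < 2"
        by (auto simp: absorbed_after_def)
      have *: "num_cuts n G \<omega> = i"
        unfolding num
      proof (rule Least_equality)
        show "1 \<le> i \<and> card (verts (G i \<omega>)) < 2" using i(1) at by simp
        show "i \<le> t" if "1 \<le> t \<and> card (verts (G t \<omega>)) < 2" for t
          using that before[of t] by (meson leD leI)
      qed
      have "absorbed_after 0 j G \<omega> \<longleftrightarrow> j = i"
        using i(2) absorbed_after_unique by metis
      then show ?case using * elim by auto
    qed
    show "{\<omega> \<in> space M. num_cuts n G \<omega> = j} \<in> events"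
      unfolding num by measurable
  qed measurable
  then show ?thesis by (simp add: prob_absorbed_after)
qed

end

theorem proposition3p2:
  fixes M :: "nat \<Rightarrow> 'a measure" and G :: "nat \<Rightarrow> nat \<Rightarrow> 'a \<Rightarrow> ltree"
    and K :: "nat \<Rightarrow> 'a \<Rightarrow> nat"
  assumes process: "\<And>n. n \<ge> 2 \<Longrightarrow> degree_biased_process n (M n) (G n)"
    and K: "\<And>n. K n = num_cuts n (G n)"
  shows "\<P>(\<omega> in M 2. K 2 \<omega> = 1) = 1 \<and>
    \<P>(\<omega> in M 3. K 3 \<omega> = 1) = 1 \<and>
    (\<forall>n\<ge>4.
      \<P>(\<omega> in M n. K n \<omega> = 1) =
        harm (n - 2) / (real n - 1)\<^sup>2 + harm (n - 1) / (real n - 1) \<and>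
      (\<forall>j\<ge>2. \<P>(\<omega> in M n. K n \<omega> = j) =
        (\<Sum>k=2..n-2. real n * harm (k - 1) / (real k * real (k + 1) * (real n - 1)) *
           \<P>(\<omega> in M (n - k). K (n - k) \<omega> = j - 1))))"
proof -
  have law: "\<P>(\<omega> in M n. K n \<omega> = j) = mean_absorb_prob j n" if "n \<ge> 2" "j \<ge> 1" for n j
  proof -
    interpret cut_process "M n" n "G n"
      using process[OF that(1)] that(1)
      by (auto simp: cut_process_def cut_process_axioms_def degree_biased_process_def)
    show ?thesis unfolding K by (rule prob_num_cuts[OF that(2)])
  qed
  have small: "\<P>(\<omega> in M 2. K 2 \<omega> = 1) = 1" "\<P>(\<omega> in M 3. K 3 \<omega> = 1) = 1"
    by (simp_all add: law mean_absorb_prob_1[simplified] harm_expand power2_eq_square)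
  have first: "\<P>(\<omega> in M n. K n \<omega> = 1) = harm (n - 2) / (real n - 1)\<^sup>2 + harm (n - 1) / (real n - 1)"
    if "n \<ge> 4" for n
    using that law[of n 1] mean_absorb_prob_1[of n] by simp
  have later: "\<P>(\<omega> in M n. K n \<omega> = j) =
      (\<Sum>k=2..n-2. real n * harm (k - 1) / (real k * real (k + 1) * (real n - 1)) *
         \<P>(\<omega> in M (n - k). K (n - k) \<omega> = j - 1))" if "n \<ge> 4" "j \<ge> 2" for n j
  proof -
    obtain i where j: "j = Suc (Suc i)" using \<open>j \<ge> 2\<close> by (metis add_2_eq_Suc le_Suc_ex)
    have "\<P>(\<omega> in M n. K n \<omega> = j) = mean_absorb_prob (Suc (Suc i)) n"
      using that law j by simp
    also have "\<dots> = (\<Sum>k=2..n-2. real n * harm (k - 1) / (real k * real (k + 1) * (real n - 1)) *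
         mean_absorb_prob (Suc i) (n - k))"
      using that by (intro mean_absorb_prob_Suc_Suc) simp
    moreover have "mean_absorb_prob (Suc i) (n - k) = \<P>(\<omega> in M (n - k). K (n - k) \<omega> = j - 1)"
      if "k \<in> {2..n - 2}" for k
    proof -
      have "n - k \<ge> 2" using that \<open>n \<ge> 4\<close> by auto
      then show ?thesis using law[of "n - k" "Suc i"] j by simp
    qed
    ultimately show ?thesis by simp
  qed
  show ?thesis using small first later by blast
qed

end
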